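(* For any $d_1\ge2$ and $d_2\ge4$ there exists a decomposable map $P:\mathcal{M}_{d_1}\to\mathcal{M}_{d_2}$ such that $P\otimes P$ is positive and not decomposable.
   Context: A linear map $L:\mathcal{M}_{n}\to\mathcal{M}_{m}$ is positive if it maps positive semidefinite matrices to positive semidefinite matrices, and decomposable if $L=T+\vartheta_m\circ S$ for completely positive $T,S$, with $\vartheta_m$ the transpose on $\mathcal{M}_m$. *)

theory Defs
  imports Complex_Main "Jordan_Normal_Form.Matrix"
begin

definition psd :: "nat \<Rightarrow> complex mat \<Rightarrow> bool" where
  "psd n A \<longleftrightarrow> A \<in> carrier_mat n n \<and> A = mat n n (\<lambda>(i,j). cnj (A $$ (j,i))) \<and>
     (\<forall>v :: nat \<Rightarrow> complex.
        let q = (\<Sum>i<n. \<Sum>j<n. cnj (v i) * A $$ (i,j) * v j) in Im q = 0 \<and> Re q \<ge> 0)"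

definition lin_map :: "nat \<Rightarrow> nat \<Rightarrow> (complex mat \<Rightarrow> complex mat) \<Rightarrow> bool" where
  "lin_map n m L \<longleftrightarrow>
     (\<forall>A \<in> carrier_mat n n. L A \<in> carrier_mat m m) \<and>
     (\<forall>A \<in> carrier_mat n n. \<forall>B \<in> carrier_mat n n. L (A + B) = L A + L B) \<and>
     (\<forall>A \<in> carrier_mat n n. \<forall>c. L (c \<cdot>\<^sub>m A) = c \<cdot>\<^sub>m L A)"

definition positive_map :: "nat \<Rightarrow> nat \<Rightarrow> (complex mat \<Rightarrow> complex mat) \<Rightarrow> bool" where
  "positive_map n m L \<longleftrightarrow> lin_map n m L \<and> (\<forall>A. psd n A \<longrightarrow> psd m (L A))"

text \<open>Kronecker product, identifying M_a \<otimes> M_b with M_(a*b) via index (i,k) |-> i*b+k.\<close>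
definition kron :: "complex mat \<Rightarrow> complex mat \<Rightarrow> complex mat" where
  "kron A B = mat (dim_row A * dim_row B) (dim_col A * dim_col B)
     (\<lambda>(i,j). A $$ (i div dim_row B, j div dim_col B) * B $$ (i mod dim_row B, j mod dim_col B))"

definition mat_unit :: "nat \<Rightarrow> nat \<Rightarrow> nat \<Rightarrow> complex mat" where
  "mat_unit n i j = mat n n (\<lambda>(a,b). if a = i \<and> b = j then 1 else 0)"

text \<open>Tensor product of linear maps P : M_n1 -> M_m1 and Q : M_n2 -> M_m2,
  as the linear map M_(n1*n2) -> M_(m1*m2) determined on matrix units by
  E_ij \<otimes> E_kl |-> P(E_ij) \<otimes> Q(E_kl).\<close>
definition tensor_map :: "nat \<Rightarrow> nat \<Rightarrow> nat \<Rightarrow> nat \<Rightarrow>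
    (complex mat \<Rightarrow> complex mat) \<Rightarrow> (complex mat \<Rightarrow> complex mat) \<Rightarrow> complex mat \<Rightarrow> complex mat" where
  "tensor_map n1 m1 n2 m2 P Q X = mat (m1 * m2) (m1 * m2) (\<lambda>(r,c).
     \<Sum>i<n1. \<Sum>j<n1. \<Sum>k<n2. \<Sum>l<n2.
       X $$ (i * n2 + k, j * n2 + l) * kron (P (mat_unit n1 i j)) (Q (mat_unit n2 k l)) $$ (r,c))"

definition completely_positive :: "nat \<Rightarrow> nat \<Rightarrow> (complex mat \<Rightarrow> complex mat) \<Rightarrow> bool" where
  "completely_positive n m L \<longleftrightarrow> lin_map n m L \<and>
     (\<forall>k. positive_map (k * n) (k * m) (tensor_map k k n m (\<lambda>A. A) L))"

definition decomposable :: "nat \<Rightarrow> nat \<Rightarrow> (complex mat \<Rightarrow> complex mat) \<Rightarrow> bool" where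
  "decomposable n m L \<longleftrightarrow> (\<exists>T S. completely_positive n m T \<and> completely_positive n m S \<and>
     (\<forall>A \<in> carrier_mat n n. L A = T A + transpose_mat (S A)))"

end

theory Submission
  imports Defs
begin

text \<open>
  On the block of X spanned by the first two basis vectors, P acts as V + W + \<beta> E, where on a
  rank-one input x x* the completely positive V and E give v v* with v = (x0, \<mu> x1, 0) and
  diag(0, |x0|^2, |x1|^2), and the completely copositive W gives w w* with w = (0, cnj x1, cnj x0).
  In the expansion of P \<otimes> P only V \<otimes> W + W \<otimes> V fails to be positive. For fixed input
  its negative part is at most of order \<mu>^2/\<beta>, along directions to which \<beta> (E \<otimes> W + W \<otimes> E)
  contributes \<beta>, unless one row or column of the input (as a 2 x 2 matrix) is much smaller than the
  other; then the terms W \<otimes> W and \<beta>^2 E \<otimes> E help out. So \<beta> much larger than \<mu> suffices for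
  positivity. A decomposition of P \<otimes> P, however, has to share a few diagonal Choi entries between its
  completely positive and its completely copositive part, and this is impossible as soon as
  3 \<beta>^3 is smaller than roughly \<mu>^2. For small parameters the two regimes overlap; this
  already happens with values in the 3 x 3 matrices.
\<close>

section \<open>The inequality behind positivity\<close>

lemma norm_add_sq_le: "(norm (x + y :: complex))\<^sup>2 \<le> 2 * (norm x)\<^sup>2 + 2 * (norm y)\<^sup>2"
proof -
  have "(norm (x + y))\<^sup>2 \<le> (norm x + norm y)\<^sup>2"
    by (simp add: power_mono norm_triangle_ineq)
  also have "\<dots> \<le> 2 * (norm x)\<^sup>2 + 2 * (norm y)\<^sup>2"
    using zero_le_power2[of "norm x - norm y"] by (simp add: power2_eq_square algebra_simps)
  finally show ?thesis .
qed

lemma norm_lincomb_sq_le: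
  "(norm (x * y + z * w :: complex))\<^sup>2 \<le> ((norm x)\<^sup>2 + (norm z)\<^sup>2) * ((norm y)\<^sup>2 + (norm w)\<^sup>2)"
proof -
  have "norm (x * y + z * w) \<le> norm x * norm y + norm z * norm w"
    by (metis norm_mult norm_triangle_ineq)
  hence "(norm (x * y + z * w))\<^sup>2 \<le> (norm x * norm y + norm z * norm w)\<^sup>2"
    by (simp add: power_mono)
  also have "\<dots> \<le> ((norm x)\<^sup>2 + (norm z)\<^sup>2) * ((norm y)\<^sup>2 + (norm w)\<^sup>2)"
    using zero_le_power2[of "norm x * norm w - norm z * norm y"]
    by (simp add: power2_eq_square algebra_simps)
  finally show ?thesis .
qed

lemma quadratic_nonneg:
  fixes a b c x y :: real
  assumes "a \<ge> 0" "c \<ge> 0" "b\<^sup>2 \<le> a * c"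
  shows "a * x\<^sup>2 + c * y\<^sup>2 - 2 * b * x * y \<ge> 0"
proof (cases "a = 0")
  case True
  then show ?thesis using assms by auto
next
  case False
  have "a * (a * x\<^sup>2 + c * y\<^sup>2 - 2 * b * x * y) = (a * x - b * y)\<^sup>2 + (a * c - b\<^sup>2) * y\<^sup>2"
    by (simp add: power2_eq_square algebra_simps)
  also have "\<dots> \<ge> 0" using assms by simp
  finally show ?thesis using False assms(1) by (simp add: zero_le_mult_iff)
qed

section \<open>Lower bounds for the two indefinite brackets of the form\<close>

text \<open>
  The first bracket is the quadratic form of V \<otimes> W + \<beta> V \<otimes> E. Over the free
  coordinates it is bounded below by a rank-one form, since p n - q m and p v - q u do not involve them.
\<close>
lemma block_form_bound:
  fixes p q m n u v :: complex and \<beta> :: real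
  assumes \<beta>: "\<beta> > 0"
  defines "P \<equiv> (norm p)\<^sup>2" and "Q \<equiv> (norm q)\<^sup>2"
  defines "N \<equiv> P\<^sup>2 + \<beta> * P * Q + Q\<^sup>2"
  shows "\<beta> * N * ((norm u)\<^sup>2 + (norm n)\<^sup>2 + 2 * Re (v * cnj m) + \<beta> * ((norm m)\<^sup>2 + (norm v)\<^sup>2))
          + (norm (cnj q * (p * n - q * m) + cnj p * (p * v - q * u)))\<^sup>2 \<ge> 0"
    (is "\<beta> * N * (?U + ?c2 + ?MV) + ?Z \<ge> 0" is "?total \<ge> 0")
proof (cases "p = 0 \<and> q = 0")
  case True
  then show ?thesis by (simp add: N_def P_def Q_def)
next
  case False
  define X where "X = (norm u)\<^sup>2 + (norm n)\<^sup>2"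
  \<comment> \<open>The last norm of the claim is that of \<open>w + y\<close>, where
    \<open>w\<close> contains only n and u, whose squares occur positively, and \<open>y\<close>
    only m and v, which carry the indefinite term.\<close>
  define w where "w = cnj q * p * n - cnj p * q * u"
  define y where "y = of_real P * v - of_real Q * m"
  define c where "c = Re (v * cnj m)"
  define k where "k = 2 * P * Q"
  define T where "T = \<beta> * N + k"
  define V where "V = norm v"
  define M where "M = norm m"
  have PQ: "P \<ge> 0" "Q \<ge> 0" by (auto simp: P_def Q_def)
  have N0: "N \<ge> 0" using PQ \<beta> by (simp add: N_def)
  have k0: "k \<ge> 0" using PQ by (simp add: k_def)
  have X0: "X \<ge> 0" by (simp add: X_def)
  have "P > 0 \<or> Q > 0" using False by (auto simp: P_def Q_def)
  hence "P\<^sup>2 + Q\<^sup>2 > 0" by (auto simp: sum_power2_gt_zero_iff)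
  moreover have "\<beta> * P * Q \<ge> 0" using PQ \<beta> by simp
  ultimately have "N > 0" by (simp add: N_def)
  hence T0: "T > 0" using \<beta> k0 by (simp add: T_def add_pos_nonneg)
  have Zeq: "?Z = (norm (w + y))\<^sup>2"
  proof -
    have "cnj q * (p * n - q * m) + cnj p * (p * v - q * u) = w + y"
      unfolding w_def y_def P_def Q_def complex_norm_square by (simp add: algebra_simps)
    thus ?thesis by simp
  qed
  have ww: "(norm w)\<^sup>2 \<le> k * X"
  proof -
    have "(norm w)\<^sup>2 \<le> 2 * (norm (cnj q * p * n))\<^sup>2 + 2 * (norm (- (cnj p * q * u)))\<^sup>2"
      using norm_add_sq_le[of "cnj q * p * n" "- (cnj p * q * u)"] by (simp add: w_def)
    thus ?thesis by (simp add: norm_mult power_mult_distrib k_def X_def P_def Q_def algebra_simps)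
  qed
  \<comment> \<open>Weighted Cauchy-Schwarz for y = (w + y) - w. The weights are chosen so that the
    total constant is exactly \<open>T = \<beta> * N + k\<close>.\<close>
  have step: "\<beta> * N * (norm y)\<^sup>2 \<le> T * (\<beta> * N * X + (norm (w + y))\<^sup>2)"
  proof -
    define \<alpha> where "\<alpha> = norm (w + y)"
    define \<omega> where "\<omega> = norm w"
    define b where "b = \<beta> * N"
    have b0: "b \<ge> 0" using \<beta> N0 by (simp add: b_def)
    have \<alpha>0: "\<alpha> \<ge> 0" and \<omega>0: "\<omega> \<ge> 0" by (auto simp: \<alpha>_def \<omega>_def)
    have "norm y \<le> \<alpha> + \<omega>"
      unfolding \<alpha>_def \<omega>_def using norm_triangle_ineq4[of "w + y" w] by simp
    hence "(norm y)\<^sup>2 \<le> (\<alpha> + \<omega>)\<^sup>2" by (simp add: power_mono)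
    hence 1: "b * (norm y)\<^sup>2 \<le> b * (\<alpha> + \<omega>)\<^sup>2" using b0 by (rule mult_left_mono)
    have "\<omega> \<le> sqrt (k * X)" using ww by (simp add: \<omega>_def real_le_rsqrt)
    hence "2 * b * \<alpha> * \<omega> \<le> 2 * b * \<alpha> * sqrt (k * X)"
      using b0 \<alpha>0 by (simp add: mult_left_mono)
    also have "\<dots> \<le> b\<^sup>2 * X + k * \<alpha>\<^sup>2"
    proof -
      have "0 \<le> (b * sqrt X - sqrt k * \<alpha>)\<^sup>2" by simp
      also have "\<dots> = b\<^sup>2 * X + k * \<alpha>\<^sup>2 - 2 * b * \<alpha> * sqrt (k * X)"
        using X0 k0 by (simp add: power2_diff power_mult_distrib real_sqrt_mult)
      finally show ?thesis by simp
    qed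
    finally have 2: "2 * b * \<alpha> * \<omega> \<le> b\<^sup>2 * X + k * \<alpha>\<^sup>2" .
    have 3: "b * \<omega>\<^sup>2 \<le> b * (k * X)" using ww b0 by (simp add: \<omega>_def mult_left_mono)
    have "b * (\<alpha> + \<omega>)\<^sup>2 = b * \<alpha>\<^sup>2 + 2 * b * \<alpha> * \<omega> + b * \<omega>\<^sup>2"
      by (simp add: power2_eq_square algebra_simps)
    also have "\<dots> \<le> b * \<alpha>\<^sup>2 + (b\<^sup>2 * X + k * \<alpha>\<^sup>2) + b * (k * X)" using 2 3 by linarith
    also have "\<dots> = (b + k) * (b * X + \<alpha>\<^sup>2)" by (simp add: power2_eq_square algebra_simps)
    finally show ?thesis using 1 by (simp add: b_def T_def \<alpha>_def)
  qed
  have yy: "(norm y)\<^sup>2 = P\<^sup>2 * V\<^sup>2 + Q\<^sup>2 * M\<^sup>2 - 2 * P * Q * c"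
    unfolding y_def V_def M_def c_def cmod_power2
    by (simp add: power2_eq_square algebra_simps)
  have cV: "c \<ge> - (V * M)"
    using abs_Re_le_cmod[of "v * cnj m"] by (simp add: c_def V_def M_def norm_mult)
  have Tk: "T \<ge> 2 * P * Q" using \<beta> N0 by (simp add: T_def k_def)
  \<comment> \<open>Since T \<ge> P Q, the left side increases with c, so the worst phase is c = - V
    M. What remains is a real form in V and M.\<close>
  have form: "T * (2 * c + \<beta> * (M\<^sup>2 + V\<^sup>2)) + (norm y)\<^sup>2 \<ge> 0"
  proof -
    have "0 \<le> (\<beta> * T + P\<^sup>2) * V\<^sup>2 + (\<beta> * T + Q\<^sup>2) * M\<^sup>2 - 2 * (T - P * Q) * V * M"
    proof (rule quadratic_nonneg)
      show "\<beta> * T + P\<^sup>2 \<ge> 0" "\<beta> * T + Q\<^sup>2 \<ge> 0" using \<beta> T0 by auto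
      \<comment> \<open>The determinant condition, divided by T, is T \<le> \<beta>^2 T + \<beta>
        (P^2 + Q^2) + 2 P Q. By the choice of N both sides agree except for \<beta>^2 P Q on the
        left and \<beta>^2 T on the right.\<close>
      have "\<beta>\<^sup>2 * T \<ge> \<beta>\<^sup>2 * (P * Q)"
      proof (rule mult_left_mono)
        have "P * Q \<ge> 0" using PQ by simp
        thus "P * Q \<le> T" using Tk by simp
      qed simp
      hence "T \<le> \<beta>\<^sup>2 * T + \<beta> * (P\<^sup>2 + Q\<^sup>2) + 2 * P * Q"
        by (simp add: T_def N_def k_def power2_eq_square algebra_simps)
      hence "T * T \<le> T * (\<beta>\<^sup>2 * T + \<beta> * (P\<^sup>2 + Q\<^sup>2) + 2 * P * Q)"
        using T0 by (intro mult_left_mono) auto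
      thus "(T - P * Q)\<^sup>2 \<le> (\<beta> * T + P\<^sup>2) * (\<beta> * T + Q\<^sup>2)"
        by (simp add: power2_eq_square algebra_simps)
    qed
    also have "\<dots> = T * (- 2 * (V * M) + \<beta> * (M\<^sup>2 + V\<^sup>2)) + P\<^sup>2 * V\<^sup>2 + Q\<^sup>2 * M\<^sup>2 + 2 * P * Q * (V * M)"
      by (simp add: algebra_simps)
    also have "\<dots> \<le> T * (2 * c + \<beta> * (M\<^sup>2 + V\<^sup>2)) + (norm y)\<^sup>2"
    proof -
      have "P * Q \<ge> 0" using PQ by simp
      hence "T - P * Q \<ge> 0" using Tk by simp
      hence "0 \<le> 2 * ((T - P * Q) * (c + V * M))" using cV by simp
      thus ?thesis unfolding yy by (simp add: algebra_simps)
    qed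
    finally show ?thesis .
  qed
  have "0 \<le> \<beta> * N * (T * (2 * c + \<beta> * (M\<^sup>2 + V\<^sup>2)) + (norm y)\<^sup>2)"
    using form \<beta> N0 by simp
  also have "\<dots> \<le> T * ?total"
    using step unfolding Zeq by (simp add: X_def c_def M_def V_def algebra_simps)
  finally show ?thesis using T0 by (simp add: zero_le_mult_iff)
qed

text \<open>The free coordinates s and s' cancel: p n - q m = \<mu> a D and p v - q u = \<mu> b D
  with D = p t - q r. So \<open>block_form_bound\<close> limits the negative part of B to \<mu>^2
  |D|^2 Z / (\<beta> N), where Z = |a cnj q + b cnj p|^2. If (p, q) is not too small against (r, t),
  this is at most half of the term \<beta> Z that E \<otimes> W supplies; the second bound serves
  the remaining inputs. The number \<nu> = 2 \<mu>^2 / \<beta>^2 measures what counts as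
  small.\<close>

lemma bracket_bound:
  fixes p q r t s s' a b :: complex and \<beta> \<mu> \<nu> :: real
  assumes \<beta>: "\<beta> > 0" and \<nu>: "\<nu> * \<beta>\<^sup>2 = 2 * \<mu>\<^sup>2"
  defines "P \<equiv> (norm p)\<^sup>2" and "Q \<equiv> (norm q)\<^sup>2" and "S \<equiv> (norm r)\<^sup>2 + (norm t)\<^sup>2"
  defines "m \<equiv> s * p + \<mu> * a * r" and "n \<equiv> s * q + \<mu> * a * t"
  defines "u \<equiv> s' * p + \<mu> * b * r" and "v \<equiv> s' * q + \<mu> * b * t"
  defines "B \<equiv> (norm u)\<^sup>2 + (norm n)\<^sup>2 + 2 * Re (v * cnj m) + \<beta> * ((norm m)\<^sup>2 + (norm v)\<^sup>2)"
  shows "2 * \<nu> * S \<le> P + Q \<Longrightarrow> B + \<beta> / 2 * (norm (a * cnj q + b * cnj p))\<^sup>2 \<ge> 0"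
    and "B + \<beta> * \<nu> * S * ((norm a)\<^sup>2 + (norm b)\<^sup>2) \<ge> 0"
proof -
  define Z where "Z = (norm (a * cnj q + b * cnj p))\<^sup>2"
  define D where "D = p * t - q * r"
  define N where "N = P\<^sup>2 + \<beta> * P * Q + Q\<^sup>2"
  have PQ: "P \<ge> 0" "Q \<ge> 0" by (auto simp: P_def Q_def)
  have S0: "S \<ge> 0" by (simp add: S_def)
  have "\<nu> = 2 * \<mu>\<^sup>2 / \<beta>\<^sup>2" using \<nu> \<beta> by (simp add: field_simps)
  hence \<nu>0: "\<nu> \<ge> 0" by simp
  have Z0: "Z \<ge> 0" by (simp add: Z_def)
  have DB: "(norm D)\<^sup>2 \<le> (P + Q) * S"
    using norm_lincomb_sq_le[of p t "-q" r] by (simp add: D_def P_def Q_def S_def algebra_simps)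
  have key: "0 \<le> \<beta> * N * B + \<mu>\<^sup>2 * (norm D)\<^sup>2 * Z"
  proof -
    have "cnj q * (p * n - q * m) + cnj p * (p * v - q * u) = of_real \<mu> * D * (a * cnj q + b * cnj p)"
      by (simp add: m_def n_def u_def v_def D_def algebra_simps)
    hence "(norm (cnj q * (p * n - q * m) + cnj p * (p * v - q * u)))\<^sup>2 = \<mu>\<^sup>2 * (norm D)\<^sup>2 * Z"
      by (simp add: norm_mult power_mult_distrib Z_def)
    thus ?thesis using block_form_bound[OF \<beta>, of p q u n v m]
      by (simp add: N_def B_def P_def Q_def)
  qed
  \<comment> \<open>This is B \<ge> - \<beta> \<nu> S Z / (P + Q) without the division. It combines
    |D|^2 \<le> (P + Q) S with N \<ge> (P + Q)^2 / 2.\<close>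
  have main: "0 \<le> (P + Q) * B + \<beta> * \<nu> * S * Z"
  proof (cases "B \<ge> 0")
    case True
    then show ?thesis using PQ S0 Z0 \<beta> \<nu>0 by simp
  next
    case False
    show ?thesis
    proof (cases "P + Q = 0")
      case True
      then show ?thesis using S0 Z0 \<beta> \<nu>0 by simp
    next
      case F2: False
      have "0 \<le> \<beta> * P * Q" using \<beta> PQ by simp
      hence "(P + Q)\<^sup>2 \<le> 2 * N"
        using zero_le_power2[of "P - Q"] unfolding N_def power2_sum power2_diff distrib_left by linarith
      hence "(P + Q)\<^sup>2 / 2 \<le> N" by simp
      hence "\<beta> * ((P + Q)\<^sup>2 / 2) * (- B) \<le> \<beta> * N * (- B)"
        using False \<beta> by (intro mult_right_mono mult_left_mono) auto
      also have "\<dots> \<le> \<mu>\<^sup>2 * (norm D)\<^sup>2 * Z" using key by simp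
      also have "\<dots> \<le> \<mu>\<^sup>2 * ((P + Q) * S) * Z"
        using DB Z0 by (intro mult_right_mono mult_left_mono) auto
      also have "\<dots> = \<beta> * (\<nu> * \<beta> * ((P + Q) * S) * Z) / 2"
        using arg_cong[OF \<nu>, of "\<lambda>x. x * ((P + Q) * S) * Z / 2"] by (simp add: power2_eq_square algebra_simps)
      finally have "\<beta> * (P + Q) / 2 * ((P + Q) * (- B)) \<le> \<beta> * (P + Q) / 2 * (\<beta> * \<nu> * S * Z)"
        by (simp add: power2_eq_square algebra_simps)
      moreover have "\<beta> * (P + Q) / 2 > 0" using F2 PQ \<beta> by simp
      ultimately have "(P + Q) * (- B) \<le> \<beta> * \<nu> * S * Z" by (simp only: mult_le_cancel_left_pos)
      thus ?thesis by simp
    qed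
  qed
  \<comment> \<open>For p = q = 0 all four of m, n, u, v are products of one of a, b with one of r,
    t, so |v| |m| = |u| |n| and the cross term is absorbed by |u|^2 + |n|^2.\<close>
  have zero: "B \<ge> 0" if "P + Q = 0"
  proof -
    have pq: "p = 0" "q = 0" using that PQ by (auto simp: P_def Q_def add_nonneg_eq_0_iff)
    have "2 * Re (v * cnj m) \<ge> - 2 * (norm v * norm m)"
      using abs_Re_le_cmod[of "v * cnj m"] by (simp add: norm_mult)
    also have "norm v * norm m = norm u * norm n"
      by (simp add: pq m_def n_def u_def v_def norm_mult)
    finally have "(norm u)\<^sup>2 + (norm n)\<^sup>2 + 2 * Re (v * cnj m) \<ge> (norm u - norm n)\<^sup>2"
      by (simp add: power2_eq_square algebra_simps)
    hence "(norm u)\<^sup>2 + (norm n)\<^sup>2 + 2 * Re (v * cnj m) \<ge> 0"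
      by (rule order_trans[OF zero_le_power2])
    moreover have "0 \<le> \<beta> * ((norm m)\<^sup>2 + (norm v)\<^sup>2)" using \<beta> by simp
    ultimately show ?thesis unfolding B_def by linarith
  qed
  show "B + \<beta> / 2 * (norm (a * cnj q + b * cnj p))\<^sup>2 \<ge> 0" if good: "2 * \<nu> * S \<le> P + Q"
  proof (cases "P + Q = 0")
    case True
    then show ?thesis using zero \<beta> by simp
  next
    case False
    have "\<beta> * (2 * \<nu> * S) * Z \<le> \<beta> * (P + Q) * Z"
      using good \<beta> Z0 by (intro mult_right_mono mult_left_mono) auto
    hence "0 \<le> ((P + Q) * B + \<beta> * \<nu> * S * Z) + (\<beta> * (P + Q) * Z - \<beta> * (2 * \<nu> * S) * Z) / 2"
      using main by simp
    also have "\<dots> = (P + Q) * (B + \<beta> / 2 * Z)" by (simp add: field_simps)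
    finally have "0 \<le> (P + Q) * (B + \<beta> / 2 * Z)" .
    thus ?thesis using False PQ by (simp add: zero_le_mult_iff Z_def)
  qed
  show "B + \<beta> * \<nu> * S * ((norm a)\<^sup>2 + (norm b)\<^sup>2) \<ge> 0"
  proof (cases "P + Q = 0")
    case True
    then show ?thesis using zero \<beta> \<nu>0 S0 by simp
  next
    case False
    have "Z \<le> ((norm a)\<^sup>2 + (norm b)\<^sup>2) * (P + Q)"
      using norm_lincomb_sq_le[of a "cnj q" b "cnj p"] by (simp add: Z_def P_def Q_def algebra_simps)
    hence "\<beta> * \<nu> * S * Z \<le> \<beta> * \<nu> * S * (((norm a)\<^sup>2 + (norm b)\<^sup>2) * (P + Q))"
      using \<beta> \<nu>0 S0 by (intro mult_left_mono) auto
    hence "0 \<le> (P + Q) * (B + \<beta> * \<nu> * S * ((norm a)\<^sup>2 + (norm b)\<^sup>2))"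
      using main by (simp add: algebra_simps)
    thus ?thesis using False PQ by (simp add: zero_le_mult_iff)
  qed
qed


section \<open>Paying the deficits for inputs with a small row or column\<close>

text \<open>Terms with p or q are perturbations of relative size \<nu>. Apart from them, a t + b r,
  a r and b t control (|a|^2 + |b|^2) S. The perturbation costs about \<beta> \<nu>^2 (|c|^2 +
  |e|^2) S, which c t + e r and the \<beta>^2 terms cover because \<nu>^2 is far below \<beta>. Only
  half of |a r + c p|^2 is spent: the other half is reserved for the second bracket.\<close>

lemma one_small_row_bound:
  fixes p q r t a b c e :: complex and \<beta> \<nu> :: real
  assumes \<beta>: "\<beta> > 0" "\<beta> \<le> 1" and \<nu>: "0 \<le> \<nu>" "\<nu> \<le> 1 / 24" "400 * \<nu>\<^sup>2 \<le> \<beta>"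
  defines "S \<equiv> (norm r)\<^sup>2 + (norm t)\<^sup>2"
  assumes bad: "(norm p)\<^sup>2 + (norm q)\<^sup>2 \<le> 2 * \<nu> * S"
  shows "\<beta> * \<nu> * S * ((norm a)\<^sup>2 + (norm b)\<^sup>2)
    \<le> (norm (a * t + b * r + c * q + e * p))\<^sup>2
      + \<beta> * ((norm (a * r + c * p))\<^sup>2 / 2 + (norm (b * t + e * q))\<^sup>2 + (norm (c * t + e * r))\<^sup>2)
      + \<beta>\<^sup>2 * ((norm c)\<^sup>2 * (norm r)\<^sup>2 + (norm e)\<^sup>2 * (norm t)\<^sup>2)"
proof -
  define g0 where "g0 = a * t + b * r + c * q + e * p"
  define g1 where "g1 = a * r + c * p"
  define g2 where "g2 = b * t + e * q"
  define g3 where "g3 = c * t + e * r"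
  define h where "h = a * t + b * r"
  define A where "A = (norm a)\<^sup>2"
  define B where "B = (norm b)\<^sup>2"
  define C where "C = (norm c)\<^sup>2"
  define E where "E = (norm e)\<^sup>2"
  define P where "P = (norm p)\<^sup>2"
  define Q where "Q = (norm q)\<^sup>2"
  define R where "R = (norm r)\<^sup>2"
  define T where "T = (norm t)\<^sup>2"
  note d = A_def B_def C_def E_def P_def Q_def R_def T_def
  have nn: "A \<ge> 0" "B \<ge> 0" "C \<ge> 0" "E \<ge> 0" "P \<ge> 0" "Q \<ge> 0" "R \<ge> 0" "T \<ge> 0" by (auto simp: d)
  have S: "S = R + T" by (simp add: S_def d)
  have bd: "P \<le> 2 * \<nu> * S" "Q \<le> 2 * \<nu> * S" using bad nn by (auto simp: d[symmetric])
  have sq: "(norm (x * y))\<^sup>2 = (norm x)\<^sup>2 * (norm y)\<^sup>2" for x y :: complex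
    by (simp add: norm_mult power_mult_distrib)
  have CP: "C * P \<le> C * (2 * \<nu> * S)" "C * Q \<le> C * (2 * \<nu> * S)" "E * P \<le> E * (2 * \<nu> * S)" "E * Q \<le> E * (2 * \<nu> * S)"
    using bd nn by (auto intro: mult_left_mono)
  have i1: "A * R \<le> 2 * (norm g1)\<^sup>2 + 2 * (C * P)"
    using norm_add_sq_le[of g1 "- (c * p)"] by (simp add: g1_def sq d)
  have i2: "B * T \<le> 2 * (norm g2)\<^sup>2 + 2 * (E * Q)"
    using norm_add_sq_le[of g2 "- (e * q)"] by (simp add: g2_def sq d)
  have i3: "C * T \<le> 2 * (norm g3)\<^sup>2 + 2 * (E * R)"
    using norm_add_sq_le[of g3 "- (e * r)"] by (simp add: g3_def sq d)
  have i4: "E * R \<le> 2 * (norm g3)\<^sup>2 + 2 * (C * T)"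
    using norm_add_sq_le[of g3 "- (c * t)"] by (simp add: g3_def sq d)
  have i5: "A * T \<le> 2 * (norm h)\<^sup>2 + 2 * (B * R)"
    using norm_add_sq_le[of h "- (b * r)"] by (simp add: h_def sq d)
  have i6: "B * R \<le> 2 * (norm h)\<^sup>2 + 2 * (A * T)"
    using norm_add_sq_le[of h "- (a * t)"] by (simp add: h_def sq d)
  have i7: "(norm h)\<^sup>2 \<le> 2 * (norm g0)\<^sup>2 + 4 * (C * Q) + 4 * (E * P)"
  proof -
    have "(norm h)\<^sup>2 \<le> 2 * (norm g0)\<^sup>2 + 2 * (norm (c * q + e * p))\<^sup>2"
      using norm_add_sq_le[of g0 "- (c * q + e * p)"] unfolding norm_minus_cancel
      by (simp add: g0_def h_def)
    thus ?thesis using norm_add_sq_le[of "c * q" "e * p"] by (simp add: sq d)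
  qed
  \<comment> \<open>If |t| is the larger of |r| and |t|, all products reduce to E T up to
    \<open>g3\<close>; otherwise they reduce to C R. In \<open>i9\<close> the same split reduces to
    B T or A R up to \<open>h\<close>.\<close>
  have i8: "(C + E) * S \<le> 4 * (norm g3)\<^sup>2 + 6 * (C * R + E * T)"
  proof (cases "R \<le> T")
    case True
    hence "C * R \<le> C * T" "E * R \<le> E * T" using nn by (auto intro: mult_left_mono)
    moreover have "0 \<le> C * R" using nn by simp
    ultimately show ?thesis using i3 unfolding S distrib_left distrib_right by linarith
  next
    case False
    hence "C * T \<le> C * R" "E * T \<le> E * R" using nn by (auto intro: mult_left_mono)
    moreover have "0 \<le> E * T" using nn by simp
    ultimately show ?thesis using i4 unfolding S distrib_left distrib_right by linarith
  qed
  have i9: "(A + B) * S \<le> 4 * (norm h)\<^sup>2 + 6 * (A * R + B * T)"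
  proof (cases "R \<le> T")
    case True
    hence "A * R \<le> A * T" "B * R \<le> B * T" using nn by (auto intro: mult_left_mono)
    moreover have "0 \<le> A * R" using nn by simp
    ultimately show ?thesis using i5 unfolding S distrib_left distrib_right by linarith
  next
    case False
    hence "A * T \<le> A * R" "B * T \<le> B * R" using nn by (auto intro: mult_left_mono)
    moreover have "0 \<le> B * T" using nn by simp
    ultimately show ?thesis using i6 unfolding S distrib_left distrib_right by linarith
  qed
  define K where "K = (C + E) * S"
  have K0: "K \<ge> 0" using nn by (simp add: K_def S)
  have CK: "C * (2 * \<nu> * S) + E * (2 * \<nu> * S) = 2 * \<nu> * K" by (simp add: K_def algebra_simps)
  have "(A + B) * S \<le> 8 * (norm g0)\<^sup>2 + 12 * (norm g1)\<^sup>2 + 12 * (norm g2)\<^sup>2 + 12 * (C * P) + 12 * (E * Q) + 16 * (C * Q) + 16 * (E * P)"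
    using i9 i7 i1 i2 unfolding distrib_left distrib_right by linarith
  also have "\<dots> \<le> 8 * (norm g0)\<^sup>2 + 12 * (norm g1)\<^sup>2 + 12 * (norm g2)\<^sup>2 + 28 * (2 * \<nu> * K)"
    using CP CK unfolding distrib_left distrib_right by linarith
  finally have AB: "(A + B) * S \<le> 12 * ((norm g0)\<^sup>2 + (norm g1)\<^sup>2 + (norm g2)\<^sup>2) + 56 * (\<nu> * K)"
    using zero_le_power2[of "norm g0"] unfolding distrib_left distrib_right by linarith
  have b\<nu>: "0 \<le> \<beta> * \<nu>" using \<beta> \<nu> by simp
  have "\<beta> * \<nu> * S * (A + B) = (\<beta> * \<nu>) * ((A + B) * S)" by simp
  also have "\<dots> \<le> (\<beta> * \<nu>) * (12 * ((norm g0)\<^sup>2 + (norm g1)\<^sup>2 + (norm g2)\<^sup>2) + 56 * (\<nu> * K))"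
    using AB b\<nu> by (rule mult_left_mono)
  also have "\<dots> = 12 * \<beta> * \<nu> * (norm g0)\<^sup>2 + \<beta> * (12 * \<nu> * ((norm g1)\<^sup>2 + (norm g2)\<^sup>2)) + \<beta> * (56 * \<nu>\<^sup>2 * K)"
    by (simp add: power2_eq_square algebra_simps)
  also have "\<dots> \<le> (norm g0)\<^sup>2 + \<beta> * (1 / 2 * ((norm g1)\<^sup>2 + (norm g2)\<^sup>2)) + \<beta> * ((norm g3)\<^sup>2 + \<beta> * (C * R + E * T))"
  proof -
    have "12 * \<beta> * \<nu> \<le> 12 * 1 * (1 / 24)" using \<beta> \<nu> by (intro mult_mono) auto
    hence x1: "12 * \<beta> * \<nu> * (norm g0)\<^sup>2 \<le> 1 * (norm g0)\<^sup>2" by (intro mult_right_mono) auto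
    have x2: "\<beta> * (12 * \<nu> * ((norm g1)\<^sup>2 + (norm g2)\<^sup>2)) \<le> \<beta> * (1 / 2 * ((norm g1)\<^sup>2 + (norm g2)\<^sup>2))"
      using \<beta> \<nu> by (intro mult_left_mono mult_right_mono) auto
    \<comment> \<open>The factor 1/6 matches the coefficient 6 in \<open>i8\<close>; 6 * 56 = 336
      stays below 400.\<close>
    have "56 * \<nu>\<^sup>2 \<le> \<beta> / 6" using \<nu>(3) zero_le_power2[of \<nu>] by linarith
    hence "56 * \<nu>\<^sup>2 * K \<le> (\<beta> / 6) * K" using K0 by (rule mult_right_mono)
    also have "\<dots> \<le> (\<beta> / 6) * (4 * (norm g3)\<^sup>2 + 6 * (C * R + E * T))"
      using i8 \<beta> by (intro mult_left_mono) (auto simp: K_def)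
    also have "\<dots> = (2 / 3 * \<beta>) * (norm g3)\<^sup>2 + \<beta> * (C * R + E * T)" by (simp add: algebra_simps)
    also have "\<dots> \<le> 1 * (norm g3)\<^sup>2 + \<beta> * (C * R + E * T)"
      using \<beta> by (intro add_right_mono mult_right_mono) auto
    finally have "\<beta> * (56 * \<nu>\<^sup>2 * K) \<le> \<beta> * ((norm g3)\<^sup>2 + \<beta> * (C * R + E * T))"
      using \<beta> by (intro mult_left_mono) auto
    with x1 x2 show ?thesis by linarith
  qed
  also have "\<dots> \<le> (norm g0)\<^sup>2 + \<beta> * ((norm g1)\<^sup>2 / 2 + (norm g2)\<^sup>2 + (norm g3)\<^sup>2) + \<beta>\<^sup>2 * (C * R + E * T)"
  proof -
    have "0 \<le> \<beta> * (norm g2)\<^sup>2" using \<beta> by simp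
    thus ?thesis by (simp add: power2_eq_square algebra_simps)
  qed
  finally show ?thesis by (simp add: g0_def g1_def g2_def g3_def d)
qed


text \<open>If the first row and the first column are both small, t dominates and the other three
  squares are of order \<nu> |t|^2. Then a t, b t and c t are controlled by the three mixed norms on
  the right up to multiples of e. That error is of order \<beta> \<nu>^2 |e t|^2 and lies below
  \<beta>^2 |e t|^2, so both deficits can be paid together.\<close>

lemma small_row_and_column_bound:
  fixes p q r t a b c e :: complex and \<beta> \<nu> :: real
  assumes \<beta>: "\<beta> > 0" "\<beta> \<le> 1" and \<nu>: "0 \<le> \<nu>" "\<nu> \<le> 1 / 100" "400 * \<nu>\<^sup>2 \<le> \<beta>"
  assumes bad1: "(norm p)\<^sup>2 + (norm q)\<^sup>2 \<le> 2 * \<nu> * ((norm r)\<^sup>2 + (norm t)\<^sup>2)"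
    and bad2: "(norm p)\<^sup>2 + (norm r)\<^sup>2 \<le> 2 * \<nu> * ((norm q)\<^sup>2 + (norm t)\<^sup>2)"
  shows "\<beta> * \<nu> * ((norm r)\<^sup>2 + (norm t)\<^sup>2) * ((norm a)\<^sup>2 + (norm b)\<^sup>2)
      + \<beta> * \<nu> * ((norm q)\<^sup>2 + (norm t)\<^sup>2) * ((norm a)\<^sup>2 + (norm c)\<^sup>2)
    \<le> (norm (a * t + b * r + c * q + e * p))\<^sup>2
      + \<beta> * ((norm (b * t + e * q))\<^sup>2 + (norm (c * t + e * r))\<^sup>2)
      + \<beta>\<^sup>2 * ((norm e)\<^sup>2 * (norm t)\<^sup>2)"
proof -
  define g0 where "g0 = a * t + b * r + c * q + e * p"
  define g2 where "g2 = b * t + e * q"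
  define g3 where "g3 = c * t + e * r"
  define A where "A = (norm a)\<^sup>2"
  define B where "B = (norm b)\<^sup>2"
  define C where "C = (norm c)\<^sup>2"
  define E where "E = (norm e)\<^sup>2"
  define P where "P = (norm p)\<^sup>2"
  define Q where "Q = (norm q)\<^sup>2"
  define R where "R = (norm r)\<^sup>2"
  define T where "T = (norm t)\<^sup>2"
  note d = A_def B_def C_def E_def P_def Q_def R_def T_def
  have nn: "A \<ge> 0" "B \<ge> 0" "C \<ge> 0" "E \<ge> 0" "P \<ge> 0" "Q \<ge> 0" "R \<ge> 0" "T \<ge> 0" by (auto simp: d)
  have sq: "(norm (x * y))\<^sup>2 = (norm x)\<^sup>2 * (norm y)\<^sup>2" for x y :: complex
    by (simp add: norm_mult power_mult_distrib)
  have b1: "P + Q \<le> 2 * \<nu> * R + 2 * \<nu> * T" and b2: "P + R \<le> 2 * \<nu> * Q + 2 * \<nu> * T"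
    using bad1 bad2 by (auto simp: d algebra_simps)
  have \<nu>R: "2 * \<nu> * R \<le> 1 / 50 * R" and \<nu>Q: "2 * \<nu> * Q \<le> 1 / 50 * Q"
    using mult_right_mono[of "2 * \<nu>" "1 / 50" R] mult_right_mono[of "2 * \<nu>" "1 / 50" Q] \<nu> nn by auto
  \<comment> \<open>Adding \<open>b1\<close> and \<open>b2\<close> and absorbing 2 \<nu> \<le> 1/50
    gives 4 \<nu> T times 50/49; the constant 5 is rounded up.\<close>
  have "Q + R \<le> 5 * (\<nu> * T)" using b1 b2 \<nu>R \<nu>Q nn by linarith
  hence small: "Q \<le> 5 * (\<nu> * T)" "R \<le> 5 * (\<nu> * T)" "P \<le> 5 * (\<nu> * T)"
    using b1 \<nu>R nn by linarith+
  define K where "K = \<nu> * (E * T)"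
  have K0: "K \<ge> 0" using nn \<nu> by (simp add: K_def)
  have \<nu>T: "\<nu> * T \<le> 1 / 100 * T" using \<nu> nn by (intro mult_right_mono) auto
  have up: "X * Y \<le> 5 * \<nu> * (X * T)" if "Y \<le> 5 * (\<nu> * T)" "X \<ge> 0" for X Y
    using mult_left_mono[OF that] by (simp add: algebra_simps)
  have up': "X * Y \<le> 1 / 20 * (X * T)" if "Y \<le> 5 * (\<nu> * T)" "X \<ge> 0" for X Y
  proof -
    have "Y \<le> 1 / 20 * T" using that \<nu>T by linarith
    from mult_left_mono[OF this that(2)] show ?thesis by (simp add: algebra_simps)
  qed
  have i2: "B * T \<le> 2 * (norm g2)\<^sup>2 + 2 * (E * Q)"
    using norm_add_sq_le[of g2 "- (e * q)"] by (simp add: g2_def sq d)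
  have i3: "C * T \<le> 2 * (norm g3)\<^sup>2 + 2 * (E * R)"
    using norm_add_sq_le[of g3 "- (e * r)"] by (simp add: g3_def sq d)
  have EQ: "E * Q \<le> 5 * K" "E * R \<le> 5 * K" "E * P \<le> 5 * K"
    using up small nn by (auto simp: K_def mult.assoc)
  have i0: "A * T \<le> 4 * (norm g0)\<^sup>2 + 4 * (B * R + C * Q + E * P)"
  proof -
    have "A * T \<le> 2 * (norm (g0 - b * r))\<^sup>2 + 2 * (norm (c * q + e * p))\<^sup>2"
      using norm_add_sq_le[of "g0 - b * r" "- (c * q + e * p)"] unfolding norm_minus_cancel
      by (simp add: g0_def sq d)
    also have "\<dots> \<le> 2 * (2 * (norm g0)\<^sup>2 + 2 * (B * R)) + 2 * (2 * (C * Q) + 2 * (E * P))"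
      using norm_add_sq_le[of g0 "- (b * r)"] norm_add_sq_le[of "c * q" "e * p"]
      by (simp add: sq d)
    finally show ?thesis by simp
  qed
  have "A * R \<le> 1 / 20 * (A * T)" "B * R \<le> 1 / 20 * (B * T)" "A * Q \<le> 1 / 20 * (A * T)" "C * Q \<le> 1 / 20 * (C * T)"
    using up' small nn by auto
  moreover have "(R + T) * (A + B) + (Q + T) * (A + C) = A * R + B * R + A * Q + C * Q + 2 * (A * T) + B * T + C * T"
    by (simp add: algebra_simps)
  ultimately have "(R + T) * (A + B) + (Q + T) * (A + C) \<le> 10 * (norm g0)\<^sup>2 + 4 * (norm g2)\<^sup>2 + 4 * (norm g3)\<^sup>2 + 90 * K"
    using i0 i2 i3 EQ K0 zero_le_power2[of "norm g0"] zero_le_power2[of "norm g2"] zero_le_power2[of "norm g3"]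
    unfolding distrib_left by linarith
  hence "\<beta> * \<nu> * ((R + T) * (A + B) + (Q + T) * (A + C)) \<le> \<beta> * \<nu> * (10 * (norm g0)\<^sup>2 + 4 * (norm g2)\<^sup>2 + 4 * (norm g3)\<^sup>2 + 90 * K)"
    using \<beta> \<nu> by (intro mult_left_mono) auto
  also have "\<dots> = (10 * \<beta> * \<nu>) * (norm g0)\<^sup>2 + \<beta> * (4 * \<nu> * ((norm g2)\<^sup>2 + (norm g3)\<^sup>2)) + \<beta> * (90 * \<nu>\<^sup>2 * (E * T))"
    by (simp add: K_def power2_eq_square algebra_simps)
  also have "\<dots> \<le> 1 * (norm g0)\<^sup>2 + \<beta> * (1 * ((norm g2)\<^sup>2 + (norm g3)\<^sup>2)) + \<beta> * (\<beta> * (E * T))"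
  proof (intro add_mono)
    have "10 * \<beta> * \<nu> \<le> 10 * 1 * (1 / 100)" using \<beta> \<nu> by (intro mult_mono) auto
    thus "10 * \<beta> * \<nu> * (norm g0)\<^sup>2 \<le> 1 * (norm g0)\<^sup>2" by (intro mult_right_mono) auto
    show "\<beta> * (4 * \<nu> * ((norm g2)\<^sup>2 + (norm g3)\<^sup>2)) \<le> \<beta> * (1 * ((norm g2)\<^sup>2 + (norm g3)\<^sup>2))"
      using \<beta> \<nu> by (intro mult_left_mono mult_right_mono) auto
    show "\<beta> * (90 * \<nu>\<^sup>2 * (E * T)) \<le> \<beta> * (\<beta> * (E * T))"
    proof (intro mult_left_mono mult_right_mono)
      show "90 * \<nu>\<^sup>2 \<le> \<beta>" using \<nu>(3) zero_le_power2[of \<nu>] by linarith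
    qed (use \<beta> nn in auto)
  qed
  finally show ?thesis by (simp add: g0_def g2_def g3_def d power2_eq_square algebra_simps)
qed



section \<open>The form of P \<otimes> P on a rank-one input\<close>

text \<open>The sum of f i j a b weighted by the (a, b) entries of P applied to the (i, j) matrix unit.\<close>
definition contract :: "real \<Rightarrow> real \<Rightarrow> (nat \<Rightarrow> nat \<Rightarrow> nat \<Rightarrow> nat \<Rightarrow> complex) \<Rightarrow> complex" where
  "contract \<beta> \<mu> f = f 0 0 0 0 + \<mu> * f 0 1 0 1 + \<mu> * f 1 0 1 0 + \<mu>\<^sup>2 * f 1 1 1 1
     + \<beta> * f 0 0 1 1 + \<beta> * f 1 1 2 2
     + f 1 1 1 1 + f 1 0 2 1 + f 0 1 1 2 + f 0 0 2 2"

text \<open>The groups are, in order: V \<otimes> V; V \<otimes> (W + \<beta> E); (W + \<beta> E)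
  \<otimes> V; W \<otimes> W; \<beta> (E \<otimes> W + W \<otimes> E); \<beta>^2 E \<otimes> E.
  Apart from the two brackets every group is a sum of squares.\<close>

lemma contract_contract_eq:
  fixes x y :: "nat \<Rightarrow> nat \<Rightarrow> complex" and \<beta> \<mu> :: real
    and p q r t a b c e o0 s s' w w' :: complex
  defines "p \<equiv> x 0 0" and "q \<equiv> x 0 1" and "r \<equiv> x 1 0" and "t \<equiv> x 1 1"
  defines "a \<equiv> cnj (y 1 1)" and "b \<equiv> cnj (y 1 2)" and "c \<equiv> cnj (y 2 1)" and "e \<equiv> cnj (y 2 2)"
  defines "o0 \<equiv> cnj (y 0 0)" and "s \<equiv> cnj (y 0 1)" and "s' \<equiv> cnj (y 0 2)"
    and "w \<equiv> cnj (y 1 0)" and "w' \<equiv> cnj (y 2 0)"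
  shows "contract \<beta> \<mu> (\<lambda>i j a b. contract \<beta> \<mu> (\<lambda>k l a' b'. cnj (y a a') * y b b' * (x i k * cnj (x j l)))) =
    of_real ((norm (o0 * p + \<mu> * s * q + \<mu> * w * r + \<mu>\<^sup>2 * a * t))\<^sup>2
      + ((norm (s' * p + \<mu> * b * r))\<^sup>2 + (norm (s * q + \<mu> * a * t))\<^sup>2
         + 2 * Re ((s' * q + \<mu> * b * t) * cnj (s * p + \<mu> * a * r))
         + \<beta> * ((norm (s * p + \<mu> * a * r))\<^sup>2 + (norm (s' * q + \<mu> * b * t))\<^sup>2))
      + ((norm (w' * p + \<mu> * c * q))\<^sup>2 + (norm (w * r + \<mu> * a * t))\<^sup>2
         + 2 * Re ((w' * r + \<mu> * c * t) * cnj (w * p + \<mu> * a * q))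
         + \<beta> * ((norm (w * p + \<mu> * a * q))\<^sup>2 + (norm (w' * r + \<mu> * c * t))\<^sup>2))
      + (norm (a * cnj t + b * cnj r + c * cnj q + e * cnj p))\<^sup>2
      + \<beta> * ((norm (a * cnj q + b * cnj p))\<^sup>2 + (norm (c * cnj t + e * cnj r))\<^sup>2
           + (norm (a * cnj r + c * cnj p))\<^sup>2 + (norm (b * cnj t + e * cnj q))\<^sup>2)
      + \<beta>\<^sup>2 * ((norm (a * cnj p))\<^sup>2 + (norm (b * cnj q))\<^sup>2 + (norm (c * cnj r))\<^sup>2 + (norm (e * cnj t))\<^sup>2))"
proof -
  have y: "y 1 1 = cnj a" "y 1 2 = cnj b" "y 2 1 = cnj c" "y 2 2 = cnj e" "y 0 0 = cnj o0"
    "y 0 1 = cnj s" "y 0 2 = cnj s'" "y 1 0 = cnj w" "y 2 0 = cnj w'"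
    by (simp_all add: a_def b_def c_def e_def o0_def s_def s'_def w_def w'_def)
  have re: "of_real (2 * Re z) = z + cnj z" for z by (simp add: complex_add_cnj)
  show ?thesis
    \<comment> \<open>With squared norms written as z cnj z and 2 Re z as z + cnj z, the claim is a
      polynomial identity in the variables and their conjugates.\<close>
    unfolding contract_def y p_def[symmetric] q_def[symmetric] r_def[symmetric] t_def[symmetric]
      of_real_add of_real_mult[of \<beta>] of_real_mult[of "\<beta>\<^sup>2"] re complex_norm_square
    unfolding complex_cnj_add complex_cnj_mult complex_cnj_complex_of_real complex_cnj_power
      complex_cnj_cnj of_real_power
    by Groebner_Basis.algebra
qed

text \<open>There are four cases, by whether the first row and the first column are small. A bracket
  whose row or column is large enough uses half of its own term \<beta> z1 or \<beta> z2; otherwise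
  its deficit d1 or d2 is paid by the other terms. Since either use takes only half of z1 or z2, the
  mixed cases close.\<close>

lemma contract_contract_nonneg:
  fixes x y :: "nat \<Rightarrow> nat \<Rightarrow> complex" and \<beta> \<mu> \<nu> :: real
  assumes \<beta>: "\<beta> > 0" "\<beta> \<le> 1" and \<nu>: "\<nu> * \<beta>\<^sup>2 = 2 * \<mu>\<^sup>2" "\<nu> \<le> 1 / 100" "400 * \<nu>\<^sup>2 \<le> \<beta>"
  obtains \<rho> where "\<rho> \<ge> 0"
    "contract \<beta> \<mu> (\<lambda>i j a b. contract \<beta> \<mu> (\<lambda>k l a' b'. cnj (y a a') * y b b' * (x i k * cnj (x j l)))) = of_real \<rho>"
proof -
  define p where "p = x 0 0"
  define q where "q = x 0 1"
  define r where "r = x 1 0"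
  define t where "t = x 1 1"
  define a where "a = cnj (y 1 1)"
  define b where "b = cnj (y 1 2)"
  define c where "c = cnj (y 2 1)"
  define e where "e = cnj (y 2 2)"
  define s where "s = cnj (y 0 1)"
  define s' where "s' = cnj (y 0 2)"
  define w where "w = cnj (y 1 0)"
  define w' where "w' = cnj (y 2 0)"
  define o0 where "o0 = cnj (y 0 0)"
  note defs = p_def q_def r_def t_def a_def b_def c_def e_def s_def s'_def w_def w'_def o0_def
  define g where "g = (norm (o0 * p + \<mu> * s * q + \<mu> * w * r + \<mu>\<^sup>2 * a * t))\<^sup>2"
  define B1 where "B1 = (norm (s' * p + \<mu> * b * r))\<^sup>2 + (norm (s * q + \<mu> * a * t))\<^sup>2
         + 2 * Re ((s' * q + \<mu> * b * t) * cnj (s * p + \<mu> * a * r))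
         + \<beta> * ((norm (s * p + \<mu> * a * r))\<^sup>2 + (norm (s' * q + \<mu> * b * t))\<^sup>2)"
  define B2 where "B2 = (norm (w' * p + \<mu> * c * q))\<^sup>2 + (norm (w * r + \<mu> * a * t))\<^sup>2
         + 2 * Re ((w' * r + \<mu> * c * t) * cnj (w * p + \<mu> * a * q))
         + \<beta> * ((norm (w * p + \<mu> * a * q))\<^sup>2 + (norm (w' * r + \<mu> * c * t))\<^sup>2)"
  define G where "G = (norm (a * cnj t + b * cnj r + c * cnj q + e * cnj p))\<^sup>2"
  define z1 where "z1 = (norm (a * cnj q + b * cnj p))\<^sup>2"
  define z2 where "z2 = (norm (a * cnj r + c * cnj p))\<^sup>2"
  define z3 where "z3 = (norm (c * cnj t + e * cnj r))\<^sup>2"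
  define z4 where "z4 = (norm (b * cnj t + e * cnj q))\<^sup>2"
  define k1 where "k1 = (norm (a * cnj p))\<^sup>2"
  define k2 where "k2 = (norm (b * cnj q))\<^sup>2"
  define k3 where "k3 = (norm (c * cnj r))\<^sup>2"
  define k4 where "k4 = (norm (e * cnj t))\<^sup>2"
  note zdefs = g_def G_def z1_def z2_def z3_def z4_def k1_def k2_def k3_def k4_def
  have nn: "0 \<le> g" "0 \<le> G" "0 \<le> \<beta> * z1" "0 \<le> \<beta> * z2" "0 \<le> \<beta> * z3" "0 \<le> \<beta> * z4"
    "0 \<le> \<beta>\<^sup>2 * k1" "0 \<le> \<beta>\<^sup>2 * k2" "0 \<le> \<beta>\<^sup>2 * k3" "0 \<le> \<beta>\<^sup>2 * k4"
    using \<beta> by (auto simp: zdefs)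
  have "\<nu> = 2 * \<mu>\<^sup>2 / \<beta>\<^sup>2" using \<nu>(1) \<beta> by (simp add: field_simps)
  hence \<nu>0: "0 \<le> \<nu>" by simp
  define S1 where "S1 = (norm r)\<^sup>2 + (norm t)\<^sup>2"
  define S2 where "S2 = (norm q)\<^sup>2 + (norm t)\<^sup>2"
  define d1 where "d1 = \<beta> * \<nu> * S1 * ((norm a)\<^sup>2 + (norm b)\<^sup>2)"
  define d2 where "d2 = \<beta> * \<nu> * S2 * ((norm a)\<^sup>2 + (norm c)\<^sup>2)"
  note bb1 = bracket_bound[OF \<beta>(1) \<nu>(1), where p = p and q = q and r = r and t = t
      and s = s and s' = s' and a = a and b = b, folded B1_def S1_def, folded z1_def d1_def]
  note bb2 = bracket_bound[OF \<beta>(1) \<nu>(1), where p = p and q = r and r = q and t = t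
      and s = w and s' = w' and a = a and b = c, folded B2_def S2_def, folded z2_def d2_def]
  have sq: "(norm (u * v))\<^sup>2 = (norm u)\<^sup>2 * (norm v)\<^sup>2" for u v :: complex
    by (simp add: norm_mult power_mult_distrib)
  have "0 \<le> B1 + B2 + G + \<beta> * z1 + \<beta> * z2 + \<beta> * z3 + \<beta> * z4 + \<beta>\<^sup>2 * k1 + \<beta>\<^sup>2 * k2 + \<beta>\<^sup>2 * k3 + \<beta>\<^sup>2 * k4"
  proof (cases "2 * \<nu> * S1 \<le> (norm p)\<^sup>2 + (norm q)\<^sup>2")
    case good1: True
    have *: "0 \<le> B1 + \<beta> * z1 / 2" using bb1(1)[OF good1] by simp
    show ?thesis
    proof (cases "2 * \<nu> * S2 \<le> (norm p)\<^sup>2 + (norm r)\<^sup>2")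
      case True
      have "0 \<le> B2 + \<beta> * z2 / 2" using bb2(1)[OF True] by simp
      with * nn show ?thesis by linarith
    next
      case False
      \<comment> \<open>The row estimate for the transposed input: q and r change places, as do b
        and c.\<close>
      have "d2 \<le> G + \<beta> * (z1 / 2 + z3 + z4) + \<beta>\<^sup>2 * (k2 + k4)"
        using one_small_row_bound[OF \<beta> \<nu>0 _ \<nu>(3), of "cnj p" "cnj r" "cnj q" "cnj t" a c b e] False \<nu>(2)
        by (simp add: d2_def S2_def zdefs sq algebra_simps)
      hence "d2 \<le> G + \<beta> * z1 / 2 + \<beta> * z3 + \<beta> * z4 + \<beta>\<^sup>2 * k2 + \<beta>\<^sup>2 * k4"
        by (simp add: algebra_simps)
      with * bb2(2) nn show ?thesis by linarith
    qed
  next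
    case bad1: False
    show ?thesis
    proof (cases "2 * \<nu> * S2 \<le> (norm p)\<^sup>2 + (norm r)\<^sup>2")
      case True
      have *: "0 \<le> B2 + \<beta> * z2 / 2" using bb2(1)[OF True] by simp
      have "d1 \<le> G + \<beta> * (z2 / 2 + z4 + z3) + \<beta>\<^sup>2 * (k3 + k4)"
        using one_small_row_bound[OF \<beta> \<nu>0 _ \<nu>(3), of "cnj p" "cnj q" "cnj r" "cnj t" a b c e] bad1 \<nu>(2)
        by (simp add: d1_def S1_def zdefs sq algebra_simps)
      hence "d1 \<le> G + \<beta> * z2 / 2 + \<beta> * z3 + \<beta> * z4 + \<beta>\<^sup>2 * k3 + \<beta>\<^sup>2 * k4"
        by (simp add: algebra_simps)
      with * bb1(2) nn show ?thesis by linarith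
    next
      case False
      have "d1 + d2 \<le> G + \<beta> * (z4 + z3) + \<beta>\<^sup>2 * k4"
        using small_row_and_column_bound[OF \<beta> \<nu>0 \<nu>(2) \<nu>(3), of "cnj p" "cnj q" "cnj r" "cnj t" a b c e] bad1 False
        by (simp add: d1_def d2_def S1_def S2_def zdefs sq)
      hence "d1 + d2 \<le> G + \<beta> * z3 + \<beta> * z4 + \<beta>\<^sup>2 * k4"
        by (simp add: algebra_simps)
      with bb1(2) bb2(2) nn show ?thesis by linarith
    qed
  qed
  hence "0 \<le> g + B1 + B2 + G + \<beta> * (z1 + z3 + z2 + z4) + \<beta>\<^sup>2 * (k1 + k2 + k3 + k4)"
    using nn(1) by (simp add: algebra_simps)
  moreover note contract_contract_eq[of \<beta> \<mu> y x, folded defs, folded B1_def B2_def zdefs]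
  ultimately show ?thesis by (rule that)
qed

section \<open>Positive semidefinite matrices\<close>

lemma sum_div_mod:
  fixes f :: "nat \<Rightarrow> nat \<Rightarrow> 'a :: comm_monoid_add"
  shows "(\<Sum>r<n * m. f (r div m) (r mod m)) = (\<Sum>i<n. \<Sum>k<m. f i k)"
proof -
  have "(\<Sum>r<n * m. f (r div m) (r mod m)) = (\<Sum>i<n. \<Sum>r = i * m..<i * m + m. f (r div m) (r mod m))"
    by (rule sum.nat_group[symmetric])
  also have "\<dots> = (\<Sum>i<n. \<Sum>k<m. f i k)"
  proof (rule sum.cong[OF refl])
    fix i
    have "(\<Sum>r = i * m..<i * m + m. f (r div m) (r mod m)) = (\<Sum>k = 0..<m. f ((k + i * m) div m) ((k + i * m) mod m))"
      using sum.shift_bounds_nat_ivl[of "\<lambda>r. f (r div m) (r mod m)" 0 "i * m" m] by (simp add: add.commute)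
    thus "(\<Sum>r = i * m..<i * m + m. f (r div m) (r mod m)) = (\<Sum>k<m. f i k)"
      by (simp add: atLeast0LessThan)
  qed
  finally show ?thesis .
qed

lemma div_mod_less:
  fixes r n m :: nat
  assumes "r < n * m"
  shows "r div m < n" "r mod m < m"
proof -
  show "r div m < n" using assms by (simp add: less_mult_imp_div_less)
  show "r mod m < m" using assms by (cases m) auto
qed

lemma mult_add_less:
  fixes i k n m :: nat
  assumes "i < n" "k < m"
  shows "i * m + k < n * m"
proof -
  have "i * m + k < Suc i * m" using assms(2) by simp
  also have "\<dots> \<le> n * m" using assms(1) by (intro mult_right_mono) auto
  finally show ?thesis .
qed

lemma mult_add_eq_iff:
  fixes i j k l m :: nat
  assumes "k < m" "l < m"
  shows "i * m + k = j * m + l \<longleftrightarrow> i = j \<and> k = l"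
proof
  assume "i * m + k = j * m + l"
  hence "(i * m + k) div m = (j * m + l) div m" "(i * m + k) mod m = (j * m + l) mod m" by auto
  thus "i = j \<and> k = l" using assms by simp
qed auto

section \<open>Gram decompositions of positive semidefinite matrices\<close>

lemma psdI:
  assumes "A \<in> carrier_mat n n"
    and "\<And>i j. i < n \<Longrightarrow> j < n \<Longrightarrow> A $$ (i, j) = cnj (A $$ (j, i))"
    and "\<And>v. \<exists>\<rho>\<ge>0. (\<Sum>i<n. \<Sum>j<n. cnj (v i) * A $$ (i, j) * v j) = of_real \<rho>"
  shows "psd n A"
  unfolding psd_def Let_def
proof (intro conjI allI)
  show "A = mat n n (\<lambda>(i, j). cnj (A $$ (j, i)))"
  proof (rule eq_matI)
    fix i j assume "i < dim_row (mat n n (\<lambda>(i, j). cnj (A $$ (j, i))))" "j < dim_col (mat n n (\<lambda>(i, j). cnj (A $$ (j, i))))"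
    thus "A $$ (i, j) = mat n n (\<lambda>(i, j). cnj (A $$ (j, i))) $$ (i, j)"
      using assms(2)[of i j] by (simp del: complex_cnj_cancel_iff)
  qed (use assms(1) in auto)
  fix v :: "nat \<Rightarrow> complex"
  from assms(3)[of v] obtain \<rho> where "\<rho> \<ge> 0" "(\<Sum>i<n. \<Sum>j<n. cnj (v i) * A $$ (i, j) * v j) = of_real \<rho>"
    by auto
  thus "Im (\<Sum>i<n. \<Sum>j<n. cnj (v i) * A $$ (i, j) * v j) = 0"
    "Re (\<Sum>i<n. \<Sum>j<n. cnj (v i) * A $$ (i, j) * v j) \<ge> 0" by simp_all
qed (rule assms(1))

lemma psd_gramI:
  fixes z :: "'t \<Rightarrow> nat \<Rightarrow> complex"
  assumes "A \<in> carrier_mat n n" and "finite I"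
    and A: "\<And>i j. i < n \<Longrightarrow> j < n \<Longrightarrow> A $$ (i, j) = (\<Sum>t\<in>I. z t i * cnj (z t j))"
  shows "psd n A"
proof (rule psdI)
  fix v :: "nat \<Rightarrow> complex"
  have "(\<Sum>i<n. \<Sum>j<n. cnj (v i) * A $$ (i, j) * v j)
      = (\<Sum>i<n. \<Sum>j<n. \<Sum>t\<in>I. (cnj (v i) * z t i) * cnj (cnj (v j) * z t j))"
    by (intro sum.cong refl) (simp add: A sum_distrib_left sum_distrib_right mult_ac)
  also have "\<dots> = (\<Sum>t\<in>I. \<Sum>i<n. \<Sum>j<n. (cnj (v i) * z t i) * cnj (cnj (v j) * z t j))"
    by (simp only: sum.swap[of _ "{..<n}" I])
  also have "\<dots> = (\<Sum>t\<in>I. (\<Sum>i<n. cnj (v i) * z t i) * cnj (\<Sum>i<n. cnj (v i) * z t i))"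
    by (simp only: cnj_sum sum_product)
  also have "\<dots> = of_real (\<Sum>t\<in>I. (norm (\<Sum>i<n. cnj (v i) * z t i))\<^sup>2)"
    by (simp only: of_real_sum complex_norm_square)
  finally show "\<exists>\<rho>\<ge>0. (\<Sum>i<n. \<Sum>j<n. cnj (v i) * A $$ (i, j) * v j) = of_real \<rho>"
    by (intro exI[of _ "\<Sum>t\<in>I. (norm (\<Sum>i<n. cnj (v i) * z t i))\<^sup>2"]) (auto intro: sum_nonneg)
next
  fix i j assume "i < n" "j < n"
  thus "A $$ (i, j) = cnj (A $$ (j, i))" by (simp add: A mult.commute)
qed (rule assms(1))

text \<open>Induction by Schur complements: the last row and column are split off as one rank-one
  term, and the rest is again a nonnegative Hermitian form. This later reduces positivity of a map
  to rank-one inputs.\<close>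

lemma nonneg_form_rank_one_decomp:
  fixes A :: "nat \<Rightarrow> nat \<Rightarrow> complex"
  assumes "\<And>i j. i < n \<Longrightarrow> j < n \<Longrightarrow> A i j = cnj (A j i)"
    and "\<And>v. Re (\<Sum>i<n. \<Sum>j<n. cnj (v i) * A i j * v j) \<ge> 0"
  shows "\<exists>x :: nat \<Rightarrow> nat \<Rightarrow> complex. \<forall>i<n. \<forall>j<n. A i j = (\<Sum>k<n. x k i * cnj (x k j))"
  using assms
proof (induction n arbitrary: A)
  case 0
  then show ?case by simp
next
  case (Suc n)
  have nsq: "cnj z * z = of_real ((norm z)\<^sup>2)" for z
    by (simp only: complex_norm_square mult.commute)
  define d where "d = Re (A n n)"
  have Ann: "A n n = of_real d"
    using arg_cong[OF Suc.prems(1)[of n n], of Im] by (simp add: d_def complex_eq_iff)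
  have hn: "A i n = cnj (A n i)" if "i < n" for i using Suc.prems(1)[of i n] that by simp
  define l where "l v = (\<Sum>j<n. A n j * v j)" for v
  define q where "q v = (\<Sum>i<n. \<Sum>j<n. cnj (v i) * A i j * v j)" for v
  have split: "0 \<le> Re (q v) + 2 * Re (cnj s * l v) + d * (norm s)\<^sup>2" for v s
  proof -
    define v' where "v' = v(n := s)"
    have "(\<Sum>i<Suc n. \<Sum>j<Suc n. cnj (v' i) * A i j * v' j) =
       q v + (\<Sum>i<n. cnj (v i) * A i n * s) + (cnj s * l v + cnj s * A n n * s)"
      by (simp add: v'_def q_def l_def sum.distrib sum_distrib_left mult.assoc)
    also have "(\<Sum>i<n. cnj (v i) * A i n * s) = cnj (cnj s * l v)"
      by (simp add: l_def sum_distrib_left hn mult_ac)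
    also have "Re (q v + cnj (cnj s * l v) + (cnj s * l v + cnj s * A n n * s))
        = Re (q v) + 2 * Re (cnj s * l v) + d * (norm s)\<^sup>2"
    proof -
      have "cnj s * A n n * s = of_real (d * (norm s)\<^sup>2)"
      proof -
        have "cnj s * A n n * s = of_real d * (cnj s * s)" by (simp only: Ann mult_ac)
        thus ?thesis by (simp only: nsq of_real_mult)
      qed
      thus ?thesis by (simp only: plus_complex.sel Re_complex_of_real cnj.sel)
    qed
    finally show ?thesis using Suc.prems(2)[of v'] by simp
  qed
  have d0: "d \<ge> 0" using split[of "\<lambda>_. 0" 1] by (simp add: q_def l_def)
  have null: "A n j = 0" if "d = 0" "j < n" for j
  proof (rule ccontr)
    define v where "v = (\<lambda>i. if i = j then 1 else (0::complex))"
    assume ne: "A n j \<noteq> 0"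
    have lv: "l v = A n j" using that by (simp add: l_def v_def if_distrib cong: if_cong)
    \<comment> \<open>Chosen so that the cross term becomes -2 (Re (q v) + 1), which outweighs Re (q
      v); with d = 0 no quadratic term in s opposes it.\<close>
    define \<tau> where "\<tau> = (Re (q v) + 1) / (norm (A n j))\<^sup>2"
    have "0 \<le> Re (q v) + 2 * Re (cnj (- (of_real \<tau> * A n j)) * A n j)"
      using split[of v "- (of_real \<tau> * A n j)"] that(1) by (simp add: lv)
    also have "cnj (- (of_real \<tau> * A n j)) * A n j = of_real (- \<tau> * (norm (A n j))\<^sup>2)"
    proof -
      have "cnj (- (of_real \<tau> * A n j)) * A n j = of_real (- \<tau>) * (cnj (A n j) * A n j)" by simp
      thus ?thesis by (simp only: nsq of_real_mult)
    qed
    also have "Re (of_real (- \<tau> * (norm (A n j))\<^sup>2)) = - (\<tau> * (norm (A n j))\<^sup>2)" by simp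
    also have "\<tau> * (norm (A n j))\<^sup>2 = Re (q v) + 1" using ne by (simp add: \<tau>_def)
    finally have "Re (q v) \<le> - 2" by simp
    moreover have "Re (q v) \<ge> 0" using split[of v 0] by simp
    ultimately show False by simp
  qed
  \<comment> \<open>The Schur complement of the last diagonal entry. For d = 0 the quotient is 0 by
    convention, so \<open>A'\<close> is \<open>A\<close>; this is correct because the last row then
    vanishes by \<open>null\<close>.\<close>
  define A' where "A' i j = A i j - A i n * A n j / of_real d" for i j
  have "\<exists>x :: nat \<Rightarrow> nat \<Rightarrow> complex. \<forall>i<n. \<forall>j<n. A' i j = (\<Sum>k<n. x k i * cnj (x k j))"
  proof (rule Suc.IH)
    fix i j assume ij: "i < n" "j < n"
    have "A i j = cnj (A j i)" using ij by (intro Suc.prems(1)) auto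
    moreover have "A i n * A n j = cnj (A j n * A n i)"
      by (simp add: hn[OF ij(1)] hn[OF ij(2)])
    ultimately show "A' i j = cnj (A' j i)"
      by (simp only: A'_def complex_cnj_diff complex_cnj_divide complex_cnj_complex_of_real)
  next
    fix v
    have "(\<Sum>i<n. \<Sum>j<n. cnj (v i) * A' i j * v j) = q v - cnj (l v) * l v / of_real d"
    proof -
      have "cnj (l v) = (\<Sum>i<n. cnj (v i) * A i n)"
        by (simp add: l_def hn mult_ac)
      hence "cnj (l v) * l v / of_real d = (\<Sum>i<n. cnj (v i) * A i n) * (\<Sum>j<n. A n j * v j) / of_real d"
        by (simp only: l_def)
      also have "\<dots> = (\<Sum>i<n. \<Sum>j<n. cnj (v i) * (A i n * A n j / of_real d) * v j)"
        by (simp add: sum_product sum_divide_distrib mult.assoc)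
      finally show ?thesis
        by (simp only: q_def A'_def sum_subtractf right_diff_distrib left_diff_distrib)
    qed
    also have "cnj (l v) * l v / of_real d = of_real ((norm (l v))\<^sup>2 / d)"
      by (simp only: nsq of_real_divide)
    also have "Re (q v - of_real ((norm (l v))\<^sup>2 / d)) \<ge> 0"
    proof (cases "d = 0")
      case True
      then show ?thesis using split[of v 0] by simp
    next
      case False
      \<comment> \<open>Completing the square: s = - l v / d minimises the form in its last
        coordinate.\<close>
      have "cnj (- (l v / of_real d)) * l v = of_real (- (norm (l v))\<^sup>2 / d)"
      proof -
        have "cnj (- (l v / of_real d)) * l v = - (cnj (l v) * l v / of_real d)" by simp
        thus ?thesis unfolding nsq by simp
      qed
      hence "Re (cnj (- (l v / of_real d)) * l v) = - (norm (l v))\<^sup>2 / d"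
        by (simp only: Re_complex_of_real)
      moreover have "d * (norm (- (l v / of_real d)))\<^sup>2 = (norm (l v))\<^sup>2 / d"
        using False d0 by (simp add: norm_divide power_divide power2_eq_square)
      ultimately have "0 \<le> Re (q v) + 2 * (- (norm (l v))\<^sup>2 / d) + (norm (l v))\<^sup>2 / d"
        using split[of v "- (l v / of_real d)"] by (simp only:)
      thus ?thesis by simp
    qed
    finally show "Re (\<Sum>i<n. \<Sum>j<n. cnj (v i) * A' i j * v j) \<ge> 0" by simp
  qed
  then obtain x :: "nat \<Rightarrow> nat \<Rightarrow> complex"
    where x: "\<And>i j. i < n \<Longrightarrow> j < n \<Longrightarrow> A' i j = (\<Sum>k<n. x k i * cnj (x k j))" by blast
  \<comment> \<open>The vectors of the complement are extended by 0, and the new one is the last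
    column scaled by 1 / sqrt d. For d = 0 it is the zero vector.\<close>
  define y where "y k i = (if k < n then (if i < n then x k i else 0) else A i n / of_real (sqrt d))" for k i
  have An: "cnj (A i n) = A n i" if "i < Suc n" for i
  proof (cases "i = n")
    case True
    then show ?thesis by (simp add: Ann)
  next
    case False
    then show ?thesis using that hn[of i] by simp
  qed
  have sd: "complex_of_real (sqrt d) * complex_of_real (sqrt d) = of_real d"
    using d0 by (simp flip: of_real_mult)
  have "A i j = (\<Sum>k<Suc n. y k i * cnj (y k j))" if "i < Suc n" "j < Suc n" for i j
  proof -
    have "(\<Sum>k<Suc n. y k i * cnj (y k j)) = (\<Sum>k<n. y k i * cnj (y k j)) + A i n * A n j / of_real d"
      using An[of j] that by (simp add: y_def sd)
    also have "\<dots> = A i j"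
    proof (cases "i < n \<and> j < n")
      case True
      then show ?thesis using x[of i j] by (simp add: y_def A'_def diff_eq_eq)
    next
      case False
      have "(\<Sum>k<n. y k i * cnj (y k j)) = 0"
        by (rule sum.neutral) (use False in \<open>auto simp: y_def\<close>)
      moreover have "A i n * A n j / of_real d = A i j"
      proof (cases "d = 0")
        case d: True
        show ?thesis
        proof (cases "i = n")
          case True
          then show ?thesis using that null[OF d, of j] d Ann by (cases "j = n") simp_all
        next
          case i: False
          hence "j = n" using False that by simp
          moreover have "A i n = 0" using i that hn[of i] null[OF d, of i] by simp
          ultimately show ?thesis by simp
        qed
      next
        case d: False
        have "i = n \<or> j = n" using False that by auto
        thus ?thesis
        proof
          assume "i = n"
          thus ?thesis using d Ann by simp
        next
          assume "j = n"
          thus ?thesis using d Ann by simp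
        qed
      qed
      ultimately show ?thesis by simp
    qed
    finally show ?thesis by (rule sym)
  qed
  thus ?case by blast
qed

lemma psd_rank_one_decomp:
  assumes "psd n A"
  obtains x :: "nat \<Rightarrow> nat \<Rightarrow> complex"
  where "\<And>i j. i < n \<Longrightarrow> j < n \<Longrightarrow> A $$ (i, j) = (\<Sum>k<n. x k i * cnj (x k j))"
proof -
  have "\<exists>x :: nat \<Rightarrow> nat \<Rightarrow> complex. \<forall>i<n. \<forall>j<n. A $$ (i, j) = (\<Sum>k<n. x k i * cnj (x k j))"
  proof (rule nonneg_form_rank_one_decomp)
    fix i j assume ij: "i < n" "j < n"
    have "A = mat n n (\<lambda>(i, j). cnj (A $$ (j, i)))" using assms by (simp add: psd_def)
    from arg_cong[OF this, of "\<lambda>M. M $$ (i, j)"] ij show "A $$ (i, j) = cnj (A $$ (j, i))" by simp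
  qed (use assms in \<open>simp add: psd_def Let_def\<close>)
  thus ?thesis using that by blast
qed

section \<open>Completely positive maps\<close>

lemma kron_mat_unit_index:
  assumes "B \<in> carrier_mat m m" "r < k * m" "c < k * m"
  shows "kron (mat_unit k i j) B $$ (r, c)
    = (if r div m = i \<and> c div m = j then B $$ (r mod m, c mod m) else 0)"
  using assms div_mod_less[of r k m] div_mod_less[of c k m]
  by (auto simp: kron_def mat_unit_def)

lemma mat_unit_carrier: "mat_unit n i j \<in> carrier_mat n n"
  by (simp add: mat_unit_def)

lemma lin_map_carrier: "lin_map n m L \<Longrightarrow> A \<in> carrier_mat n n \<Longrightarrow> L A \<in> carrier_mat m m"
  by (simp add: lin_map_def)

text \<open>A Kronecker product with a matrix unit fills a single block, so id \<otimes> L acts on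
  each block of X separately.\<close>

lemma tensor_map_id_index:
  assumes L: "lin_map n m L" and r: "r < k * m" "c < k * m"
  shows "tensor_map k k n m (\<lambda>A. A) L X $$ (r, c)
    = (\<Sum>i<n. \<Sum>j<n. X $$ ((r div m) * n + i, (c div m) * n + j) * L (mat_unit n i j) $$ (r mod m, c mod m))"
proof -
  have rc: "r div m < k" "c div m < k" using r div_mod_less by blast+
  have "tensor_map k k n m (\<lambda>A. A) L X $$ (r, c) = (\<Sum>i'<k. \<Sum>j'<k. \<Sum>i<n. \<Sum>j<n.
      X $$ (i' * n + i, j' * n + j) * (if r div m = i' \<and> c div m = j' then L (mat_unit n i j) $$ (r mod m, c mod m) else 0))"
    using r by (simp add: tensor_map_def kron_mat_unit_index[OF lin_map_carrier[OF L mat_unit_carrier]])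
  also have "\<dots> = (\<Sum>i'<k. \<Sum>j'<k. if r div m = i' then if c div m = j' then \<Sum>i<n. \<Sum>j<n.
      X $$ (i' * n + i, j' * n + j) * L (mat_unit n i j) $$ (r mod m, c mod m) else 0 else 0)"
    by (intro sum.cong refl) auto
  also have "\<dots> = (\<Sum>i'<k. if r div m = i' then \<Sum>j'<k. if c div m = j' then \<Sum>i<n. \<Sum>j<n.
      X $$ (i' * n + i, j' * n + j) * L (mat_unit n i j) $$ (r mod m, c mod m) else 0 else 0)"
    by (intro sum.cong refl) auto
  finally show ?thesis using rc by simp
qed

lemma tensor_map_carrier: "tensor_map n1 m1 n2 m2 P Q X \<in> carrier_mat (m1 * m2) (m1 * m2)"
  by (simp add: tensor_map_def)

lemma tensor_map_lin_map: "lin_map (n1 * n2) (m1 * m2) (tensor_map n1 m1 n2 m2 P Q)"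
  unfolding lin_map_def
proof (intro conjI ballI allI)
  fix A B :: "complex mat" and c
  assume A: "A \<in> carrier_mat (n1 * n2) (n1 * n2)"
  show "tensor_map n1 m1 n2 m2 P Q (c \<cdot>\<^sub>m A) = c \<cdot>\<^sub>m tensor_map n1 m1 n2 m2 P Q A"
    using A by (intro eq_matI) (auto simp: tensor_map_def sum_distrib_left mult_add_less mult.assoc intro!: sum.cong)
  assume B: "B \<in> carrier_mat (n1 * n2) (n1 * n2)"
  show "tensor_map n1 m1 n2 m2 P Q (A + B) = tensor_map n1 m1 n2 m2 P Q A + tensor_map n1 m1 n2 m2 P Q B"
    using A B by (intro eq_matI) (auto simp: tensor_map_def sum.distrib[symmetric] mult_add_less ring_distribs intro!: sum.cong)
qed (rule tensor_map_carrier)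

section \<open>Kraus maps and Choi matrices\<close>

definition kraus :: "nat \<Rightarrow> nat \<Rightarrow> nat \<Rightarrow> (nat \<Rightarrow> nat \<Rightarrow> nat \<Rightarrow> complex) \<Rightarrow> complex mat \<Rightarrow> complex mat" where
  "kraus n m N K X = mat m m (\<lambda>(a, b). \<Sum>s<N. \<Sum>i<n. \<Sum>j<n. K s a i * X $$ (i, j) * cnj (K s b j))"

lemma lin_map_kraus: "lin_map n m (kraus n m N K)"
  unfolding lin_map_def
proof (intro conjI ballI allI)
  fix A B :: "complex mat" and c
  assume A: "A \<in> carrier_mat n n"
  show "kraus n m N K A \<in> carrier_mat m m" by (simp add: kraus_def)
  show "kraus n m N K (c \<cdot>\<^sub>m A) = c \<cdot>\<^sub>m kraus n m N K A"
    using A by (intro eq_matI) (auto simp: kraus_def sum_distrib_left mult_ac intro!: sum.cong)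
  assume B: "B \<in> carrier_mat n n"
  show "kraus n m N K (A + B) = kraus n m N K A + kraus n m N K B"
    using A B by (intro eq_matI) (auto simp: kraus_def sum.distrib[symmetric] ring_distribs intro!: sum.cong)
qed

lemma kraus_mat_unit_index:
  assumes "a < m" "b < m" "k < n" "l < n"
  shows "kraus n m N K (mat_unit n k l) $$ (a, b) = (\<Sum>s<N. K s a k * cnj (K s b l))"
proof -
  have "(\<Sum>i<n. \<Sum>j<n. K s a i * mat_unit n k l $$ (i, j) * cnj (K s b j)) = K s a k * cnj (K s b l)" for s
  proof -
    have "(\<Sum>i<n. \<Sum>j<n. K s a i * mat_unit n k l $$ (i, j) * cnj (K s b j))
      = (\<Sum>i<n. \<Sum>j<n. if i = k then if j = l then K s a i * cnj (K s b j) else 0 else 0)"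
      by (intro sum.cong refl) (auto simp: mat_unit_def)
    also have "\<dots> = (\<Sum>i<n. if i = k then \<Sum>j<n. if j = l then K s a i * cnj (K s b j) else 0 else 0)"
      by (intro sum.cong refl) auto
    finally show ?thesis using assms by simp
  qed
  thus ?thesis using assms by (simp add: kraus_def)
qed

text \<open>If X is the sum of x_t x_t*, then its image under id \<otimes> L is the Gram sum of the
  vectors (1 \<otimes> K_s) x_t over all pairs (t, s).\<close>

lemma completely_positive_kraus: "completely_positive n m (kraus n m N K)"
  unfolding completely_positive_def positive_map_def
proof (intro conjI allI impI)
  fix k X
  assume "psd (k * n) X"
  then obtain x :: "nat \<Rightarrow> nat \<Rightarrow> complex" where x: "\<And>i j. i < k * n \<Longrightarrow> j < k * n \<Longrightarrow>
      X $$ (i, j) = (\<Sum>t<k * n. x t i * cnj (x t j))"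
    by (rule psd_rank_one_decomp) blast
  define z where "z = (\<lambda>(t, s) r. \<Sum>i<n. K s (r mod m) i * x t ((r div m) * n + i))"
  show "psd (k * m) (tensor_map k k n m (\<lambda>A. A) (kraus n m N K) X)"
  proof (rule psd_gramI[OF tensor_map_carrier])
    show "finite ({..<k * n} \<times> {..<N})" by simp
    fix r c assume rc: "r < k * m" "c < k * m"
    note dm = div_mod_less[OF rc(1)] div_mod_less[OF rc(2)]
    have "tensor_map k k n m (\<lambda>A. A) (kraus n m N K) X $$ (r, c)
      = (\<Sum>i<n. \<Sum>j<n. (\<Sum>t<k * n. x t ((r div m) * n + i) * cnj (x t ((c div m) * n + j)))
           * (\<Sum>s<N. K s (r mod m) i * cnj (K s (c mod m) j)))"
      unfolding tensor_map_id_index[OF lin_map_kraus rc]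
      by (intro sum.cong refl) (simp add: x dm mult_add_less kraus_mat_unit_index)
    also have "\<dots> = (\<Sum>i<n. \<Sum>j<n. \<Sum>u\<in>{..<k * n} \<times> {..<N}.
        (case u of (t, s) \<Rightarrow> (K s (r mod m) i * x t ((r div m) * n + i)) * cnj (K s (c mod m) j * x t ((c div m) * n + j))))"
      by (intro sum.cong refl, subst sum_product, subst sum.cartesian_product) (auto intro!: sum.cong)
    also have "\<dots> = (\<Sum>u\<in>{..<k * n} \<times> {..<N}. \<Sum>i<n. \<Sum>j<n.
        (case u of (t, s) \<Rightarrow> (K s (r mod m) i * x t ((r div m) * n + i)) * cnj (K s (c mod m) j * x t ((c div m) * n + j))))"
      by (simp only: sum.swap[of _ "{..<n}" "{..<k * n} \<times> {..<N}"])
    also have "\<dots> = (\<Sum>u\<in>{..<k * n} \<times> {..<N}. z u r * cnj (z u c))"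
      by (intro sum.cong refl) (auto simp: z_def sum_product)
    finally show "tensor_map k k n m (\<lambda>A. A) (kraus n m N K) X $$ (r, c)
      = (\<Sum>u\<in>{..<k * n} \<times> {..<N}. z u r * cnj (z u c))" .
  qed
qed (rule lin_map_kraus tensor_map_lin_map)+

text \<open>The Choi matrix of L is positive semidefinite; here it is tested on a real vector
  supported on the two nodes (i, a) and (j, b). The argument against decomposability draws on
  complete positivity only through this inequality.\<close>

lemma completely_positive_two_point:
  fixes x y :: real
  assumes cp: "completely_positive n m L"
    and ij: "i < n" "j < n" and ab: "a < m" "b < m"
  shows "0 \<le> x\<^sup>2 * Re (L (mat_unit n i i) $$ (a, a)) + y\<^sup>2 * Re (L (mat_unit n j j) $$ (b, b))
    + x * y * (Re (L (mat_unit n i j) $$ (a, b)) + Re (L (mat_unit n j i) $$ (b, a)))"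
proof -
  \<comment> \<open>The unnormalised maximally entangled projection, the sum of all E_ij \<otimes>
    E_ij. Its image under id \<otimes> L is the Choi matrix.\<close>
  define \<Omega> :: "complex mat" where
    "\<Omega> = mat (n * n) (n * n) (\<lambda>(r, c). if r div n = r mod n \<and> c div n = c mod n then 1 else 0)"
  have "psd (n * n) \<Omega>"
    by (rule psd_gramI[where I = "{()}" and z = "\<lambda>_ r. if r div n = r mod n then 1 else 0"])
       (auto simp: \<Omega>_def)
  hence "psd (n * m) (tensor_map n n n m (\<lambda>A. A) L \<Omega>)"
    using cp by (simp add: completely_positive_def positive_map_def)
  then obtain z :: "nat \<Rightarrow> nat \<Rightarrow> complex" where z: "\<And>r c. r < n * m \<Longrightarrow> c < n * m \<Longrightarrow>
      tensor_map n n n m (\<lambda>A. A) L \<Omega> $$ (r, c) = (\<Sum>t<n * m. z t r * cnj (z t c))"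
    by (rule psd_rank_one_decomp) blast
  have L: "lin_map n m L" using cp by (simp add: completely_positive_def)
  have entry: "L (mat_unit n i j) $$ (a, b) = (\<Sum>t<n * m. z t (i * m + a) * cnj (z t (j * m + b)))"
    if "i < n" "j < n" "a < m" "b < m" for i j a b
  proof -
    note bounds = mult_add_less[OF that(1,3)] mult_add_less[OF that(2,4)]
    have "tensor_map n n n m (\<lambda>A. A) L \<Omega> $$ (i * m + a, j * m + b)
      = (\<Sum>i'<n. \<Sum>j'<n. \<Omega> $$ (i * n + i', j * n + j') * L (mat_unit n i' j') $$ (a, b))"
      unfolding tensor_map_id_index[OF L bounds] using that by simp
    also have "\<dots> = (\<Sum>i'<n. \<Sum>j'<n. if i' = i then if j' = j then L (mat_unit n i' j') $$ (a, b) else 0 else 0)"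
      using that by (intro sum.cong refl) (auto simp: \<Omega>_def mult_add_less)
    also have "\<dots> = (\<Sum>i'<n. if i' = i then \<Sum>j'<n. if j' = j then L (mat_unit n i' j') $$ (a, b) else 0 else 0)"
      by (intro sum.cong refl) auto
    also have "\<dots> = L (mat_unit n i j) $$ (a, b)" using that by simp
    finally show ?thesis using z[OF bounds] by simp
  qed
  define u where "u t = z t (i * m + a)" for t
  define v where "v t = z t (j * m + b)" for t
  have "0 \<le> (\<Sum>t<n * m. (norm (of_real x * u t + of_real y * v t))\<^sup>2)" by (intro sum_nonneg) simp
  also have "\<dots> = (\<Sum>t<n * m. x\<^sup>2 * Re (u t * cnj (u t)) + y\<^sup>2 * Re (v t * cnj (v t))
      + x * y * (Re (u t * cnj (v t)) + Re (v t * cnj (u t))))"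
    by (intro sum.cong refl) (simp only: cmod_power2, simp add: power2_eq_square algebra_simps)
  also have "\<dots> = x\<^sup>2 * Re (L (mat_unit n i i) $$ (a, a)) + y\<^sup>2 * Re (L (mat_unit n j j) $$ (b, b))
    + x * y * (Re (L (mat_unit n i j) $$ (a, b)) + Re (L (mat_unit n j i) $$ (b, a)))"
    unfolding entry[OF ij(1) ij(1) ab(1) ab(1)] entry[OF ij(2) ij(2) ab(2) ab(2)]
      entry[OF ij ab] entry[OF ij(2) ij(1) ab(2) ab(1)] u_def[symmetric] v_def[symmetric] Re_sum
    by (simp only: sum.distrib sum_distrib_left[symmetric])
  finally show ?thesis .
qed

section \<open>The map\<close>

definition unit_entry :: "nat \<Rightarrow> nat \<Rightarrow> nat \<Rightarrow> nat \<Rightarrow> complex" where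
  "unit_entry a\<^sub>0 i\<^sub>0 a i = (if a = a\<^sub>0 \<and> i = i\<^sub>0 then 1 else 0)"

text \<open>The operator for s = 0 produces V; the other two together produce \<beta> E with \<beta>
  = \<gamma>^2.\<close>

definition cp_kraus :: "real \<Rightarrow> real \<Rightarrow> nat \<Rightarrow> nat \<Rightarrow> nat \<Rightarrow> complex" where
  "cp_kraus \<gamma> \<mu> s a i =
    (if s = 0 then unit_entry 0 0 a i + \<mu> * unit_entry 1 1 a i
     else if s = 1 then \<gamma> * unit_entry 1 0 a i
     else \<gamma> * unit_entry 2 1 a i)"

text \<open>The single operator E_11 + E_20. The transpose in \<open>pmap\<close> conjugates its
  output vector and so produces W.\<close>

definition cocp_kraus :: "nat \<Rightarrow> nat \<Rightarrow> nat \<Rightarrow> complex" where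
  "cocp_kraus s a i = unit_entry 1 1 a i + unit_entry 2 0 a i"

text \<open>Here \<beta> = \<gamma>^2, which keeps square roots out of the Kraus operators.\<close>
definition pmap :: "nat \<Rightarrow> nat \<Rightarrow> real \<Rightarrow> real \<Rightarrow> complex mat \<Rightarrow> complex mat" where
  "pmap d1 d2 \<gamma> \<mu> X = kraus d1 d2 3 (cp_kraus \<gamma> \<mu>) X + transpose_mat (kraus d1 d2 1 cocp_kraus X)"

text \<open>Kept as a sum of ten deltas, in the order of \<open>contract\<close>, so that sums can
  be evaluated term by term. The index (1, 1, 1, 1) occurs twice, once from V and once from
  W.\<close>

definition pcoef :: "real \<Rightarrow> real \<Rightarrow> nat \<Rightarrow> nat \<Rightarrow> nat \<Rightarrow> nat \<Rightarrow> complex" where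
  "pcoef \<beta> \<mu> i j a b =
      (if i = 0 \<and> j = 0 \<and> a = 0 \<and> b = 0 then (1::complex) else 0)
    + (if i = 0 \<and> j = 1 \<and> a = 0 \<and> b = 1 then of_real \<mu> else 0)
    + (if i = 1 \<and> j = 0 \<and> a = 1 \<and> b = 0 then of_real \<mu> else 0)
    + (if i = 1 \<and> j = 1 \<and> a = 1 \<and> b = 1 then of_real (\<mu>\<^sup>2) else 0)
    + (if i = 0 \<and> j = 0 \<and> a = 1 \<and> b = 1 then of_real \<beta> else 0)
    + (if i = 1 \<and> j = 1 \<and> a = 2 \<and> b = 2 then of_real \<beta> else 0)
    + (if i = 1 \<and> j = 1 \<and> a = 1 \<and> b = 1 then 1 else 0)
    + (if i = 1 \<and> j = 0 \<and> a = 2 \<and> b = 1 then 1 else 0)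
    + (if i = 0 \<and> j = 1 \<and> a = 1 \<and> b = 2 then 1 else 0)
    + (if i = 0 \<and> j = 0 \<and> a = 2 \<and> b = 2 then 1 else 0)"

lemma unit_entry_mult:
  "unit_entry a\<^sub>0 i\<^sub>0 a i * unit_entry b\<^sub>0 j\<^sub>0 b j = (if i = i\<^sub>0 \<and> j = j\<^sub>0 \<and> a = a\<^sub>0 \<and> b = b\<^sub>0 then 1 else 0)"
  by (simp add: unit_entry_def)

lemma cnj_unit_entry: "cnj (unit_entry a\<^sub>0 i\<^sub>0 a i) = unit_entry a\<^sub>0 i\<^sub>0 a i"
  by (simp add: unit_entry_def)

lemma pmap_mat_unit_index:
  assumes "i < d1" "j < d1" "a < d2" "b < d2"
  shows "pmap d1 d2 \<gamma> \<mu> (mat_unit d1 i j) $$ (a, b) = pcoef (\<gamma>\<^sup>2) \<mu> i j a b"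
proof -
  have dim: "dim_row (kraus d1 d2 N K X) = d2" "dim_col (kraus d1 d2 N K X) = d2" for N K X
    by (simp_all add: kraus_def)
  have "pmap d1 d2 \<gamma> \<mu> (mat_unit d1 i j) $$ (a, b)
    = (\<Sum>s<3. cp_kraus \<gamma> \<mu> s a i * cnj (cp_kraus \<gamma> \<mu> s b j))
      + (\<Sum>s<1. cocp_kraus s b i * cnj (cocp_kraus s a j))"
    using assms by (simp add: pmap_def kraus_mat_unit_index dim)
  also have "\<dots> = (unit_entry 0 0 a i + \<mu> * unit_entry 1 1 a i) * (unit_entry 0 0 b j + \<mu> * unit_entry 1 1 b j)
      + (\<gamma> * unit_entry 1 0 a i) * (\<gamma> * unit_entry 1 0 b j) + (\<gamma> * unit_entry 2 1 a i) * (\<gamma> * unit_entry 2 1 b j)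
      + (unit_entry 1 1 b i + unit_entry 2 0 b i) * (unit_entry 1 1 a j + unit_entry 2 0 a j)"
    by (simp add: numeral_3_eq_3 cp_kraus_def cocp_kraus_def cnj_unit_entry)
  also have "\<dots> = unit_entry 0 0 a i * unit_entry 0 0 b j + \<mu> * (unit_entry 0 0 a i * unit_entry 1 1 b j)
      + \<mu> * (unit_entry 1 1 a i * unit_entry 0 0 b j) + \<mu>\<^sup>2 * (unit_entry 1 1 a i * unit_entry 1 1 b j)
      + \<gamma>\<^sup>2 * (unit_entry 1 0 a i * unit_entry 1 0 b j) + \<gamma>\<^sup>2 * (unit_entry 2 1 a i * unit_entry 2 1 b j)
      + unit_entry 1 1 b i * unit_entry 1 1 a j + unit_entry 1 1 b i * unit_entry 2 0 a j
      + unit_entry 2 0 b i * unit_entry 1 1 a j + unit_entry 2 0 b i * unit_entry 2 0 a j"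
    by (simp add: algebra_simps power2_eq_square)
  also have "\<dots> = pcoef (\<gamma>\<^sup>2) \<mu> i j a b"
    unfolding unit_entry_mult pcoef_def by (simp add: conj_commute)
  finally show ?thesis .
qed

section \<open>Evaluating sums against the coefficients of P\<close>

lemma sum_delta4:
  fixes f :: "nat \<Rightarrow> nat \<Rightarrow> nat \<Rightarrow> nat \<Rightarrow> complex"
  assumes "i\<^sub>0 < n" "j\<^sub>0 < n" "a\<^sub>0 < m" "b\<^sub>0 < m"
  shows "(\<Sum>i<n. \<Sum>j<n. \<Sum>a<m. \<Sum>b<m. (if i = i\<^sub>0 \<and> j = j\<^sub>0 \<and> a = a\<^sub>0 \<and> b = b\<^sub>0 then w else 0) * f i j a b)
    = w * f i\<^sub>0 j\<^sub>0 a\<^sub>0 b\<^sub>0"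
proof -
  let ?S = "{..<n} \<times> {..<n} \<times> {..<m} \<times> {..<m}"
  have "(\<Sum>i<n. \<Sum>j<n. \<Sum>a<m. \<Sum>b<m. (if i = i\<^sub>0 \<and> j = j\<^sub>0 \<and> a = a\<^sub>0 \<and> b = b\<^sub>0 then w else 0) * f i j a b)
    = (\<Sum>u\<in>?S. if u = (i\<^sub>0, j\<^sub>0, a\<^sub>0, b\<^sub>0) then w * f i\<^sub>0 j\<^sub>0 a\<^sub>0 b\<^sub>0 else 0)"
    unfolding sum.cartesian_product by (intro sum.cong refl) (auto split: if_splits)
  also have "\<dots> = w * f i\<^sub>0 j\<^sub>0 a\<^sub>0 b\<^sub>0" using assms by simp
  finally show ?thesis .
qed

text \<open>All ten deltas fit into n \<ge> 2 and m \<ge> 3, so the form no longer depends on the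
  dimensions.\<close>

lemma sum_pcoef_eq_contract:
  assumes "n \<ge> 2" "m \<ge> 3"
  shows "(\<Sum>i<n. \<Sum>j<n. \<Sum>a<m. \<Sum>b<m. pcoef \<beta> \<mu> i j a b * f i j a b) = contract \<beta> \<mu> f"
proof -
  have "0 < n" "1 < n" "0 < m" "1 < m" "2 < m" using assms by auto
  thus ?thesis
    unfolding pcoef_def contract_def
    by (simp only: distrib_right sum.distrib sum_delta4 mult_1 of_real_power)
qed

text \<open>Groups the indices of each tensor factor, so that the form becomes one contraction
  nested in another.\<close>

lemma sum8_reorder:
  fixes g :: "nat \<Rightarrow> nat \<Rightarrow> nat \<Rightarrow> nat \<Rightarrow> nat \<Rightarrow> nat \<Rightarrow> nat \<Rightarrow> nat \<Rightarrow> complex"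
  shows "(\<Sum>a<m. \<Sum>a'<m. \<Sum>b<m. \<Sum>b'<m. \<Sum>i<n. \<Sum>j<n. \<Sum>k<n. \<Sum>l<n. g a a' b b' i j k l)
    = (\<Sum>i<n. \<Sum>j<n. \<Sum>a<m. \<Sum>b<m. \<Sum>k<n. \<Sum>l<n. \<Sum>a'<m. \<Sum>b'<m. g a a' b b' i j k l)"
  unfolding sum.cartesian_product
  by (rule sum.reindex_bij_witness[where
        i = "\<lambda>(i, j, a, b, k, l, a', b'). (a, a', b, b', i, j, k, l)" and
        j = "\<lambda>(a, a', b, b', i, j, k, l). (i, j, a, b, k, l, a', b')"]) auto

lemma tensor_pmap_index:
  assumes "r < d2 * d2" "c < d2 * d2"
  shows "tensor_map d1 d2 d1 d2 (pmap d1 d2 \<gamma> \<mu>) (pmap d1 d2 \<gamma> \<mu>) X $$ (r, c)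
    = (\<Sum>i<d1. \<Sum>j<d1. \<Sum>k<d1. \<Sum>l<d1. X $$ (i * d1 + k, j * d1 + l) *
        (pcoef (\<gamma>\<^sup>2) \<mu> i j (r div d2) (c div d2) * pcoef (\<gamma>\<^sup>2) \<mu> k l (r mod d2) (c mod d2)))"
proof -
  have dim: "pmap d1 d2 \<gamma> \<mu> Y \<in> carrier_mat d2 d2" for Y by (simp add: pmap_def kraus_def)
  note dm = div_mod_less[OF assms(1)] div_mod_less[OF assms(2)]
  show ?thesis
    unfolding tensor_map_def using assms dim dm
    by (auto simp: kron_def carrier_matD[OF dim] pmap_mat_unit_index intro!: sum.cong)
qed

lemma tensor_pmap_mat_unit_index:
  assumes "i < d1" "j < d1" "k < d1" "l < d1" "a < d2" "b < d2" "a' < d2" "b' < d2"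
  shows "tensor_map d1 d2 d1 d2 (pmap d1 d2 \<gamma> \<mu>) (pmap d1 d2 \<gamma> \<mu>)
      (mat_unit (d1 * d1) (i * d1 + k) (j * d1 + l)) $$ (a * d2 + a', b * d2 + b')
    = pcoef (\<gamma>\<^sup>2) \<mu> i j a b * pcoef (\<gamma>\<^sup>2) \<mu> k l a' b'"
proof -
  have "tensor_map d1 d2 d1 d2 (pmap d1 d2 \<gamma> \<mu>) (pmap d1 d2 \<gamma> \<mu>)
      (mat_unit (d1 * d1) (i * d1 + k) (j * d1 + l)) $$ (a * d2 + a', b * d2 + b')
    = (\<Sum>i'<d1. \<Sum>j'<d1. \<Sum>k'<d1. \<Sum>l'<d1. (if i' = i \<and> j' = j \<and> k' = k \<and> l' = l then 1 else 0) *
        (pcoef (\<gamma>\<^sup>2) \<mu> i' j' a b * pcoef (\<gamma>\<^sup>2) \<mu> k' l' a' b'))"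
    unfolding tensor_pmap_index[OF mult_add_less[OF assms(5,7)] mult_add_less[OF assms(6,8)]]
    using assms by (intro sum.cong refl) (auto simp: mat_unit_def mult_add_less mult_add_eq_iff)
  thus ?thesis using assms by (simp only: sum_delta4 mult_1)
qed

lemma cnj_pcoef: "cnj (pcoef \<beta> \<mu> i j a b) = pcoef \<beta> \<mu> j i b a"
  by (simp add: pcoef_def conj_commute if_distrib[of cnj] ac_simps cong: if_cong)

section \<open>Positivity of P \<otimes> P\<close>

text \<open>A positive semidefinite input is a sum of rank-one terms; the form of the image at v is
  the sum over these of the nested contractions bounded in
  \<open>contract_contract_nonneg\<close>.\<close>

lemma positive_map_tensor_pmap:
  fixes \<gamma> \<mu> \<nu> :: real
  assumes d: "d1 \<ge> 2" "d2 \<ge> 3" and \<gamma>: "\<gamma> > 0" "\<gamma> \<le> 1"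
    and \<nu>: "\<nu> * (\<gamma>\<^sup>2)\<^sup>2 = 2 * \<mu>\<^sup>2" "\<nu> \<le> 1 / 100" "400 * \<nu>\<^sup>2 \<le> \<gamma>\<^sup>2"
  shows "positive_map (d1 * d1) (d2 * d2) (tensor_map d1 d2 d1 d2 (pmap d1 d2 \<gamma> \<mu>) (pmap d1 d2 \<gamma> \<mu>))"
    (is "positive_map _ _ ?Q")
  unfolding positive_map_def
proof (intro conjI allI impI tensor_map_lin_map)
  fix X
  assume "psd (d1 * d1) X"
  then obtain x :: "nat \<Rightarrow> nat \<Rightarrow> complex" where x: "\<And>r c. r < d1 * d1 \<Longrightarrow> c < d1 * d1 \<Longrightarrow>
      X $$ (r, c) = (\<Sum>t<d1 * d1. x t r * cnj (x t c))"
    by (rule psd_rank_one_decomp) blast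
  define C where "C i j k l a a' b b' = pcoef (\<gamma>\<^sup>2) \<mu> i j a b * pcoef (\<gamma>\<^sup>2) \<mu> k l a' b'" for i j k l a a' b b'
  have entry: "?Q X $$ (r, c) = (\<Sum>t<d1 * d1. \<Sum>i<d1. \<Sum>j<d1. \<Sum>k<d1. \<Sum>l<d1.
      x t (i * d1 + k) * cnj (x t (j * d1 + l)) * C i j k l (r div d2) (r mod d2) (c div d2) (c mod d2))"
    if "r < d2 * d2" "c < d2 * d2" for r c
  proof -
    have "?Q X $$ (r, c) = (\<Sum>i<d1. \<Sum>j<d1. \<Sum>k<d1. \<Sum>l<d1. \<Sum>t<d1 * d1.
      x t (i * d1 + k) * cnj (x t (j * d1 + l)) * C i j k l (r div d2) (r mod d2) (c div d2) (c mod d2))"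
      unfolding tensor_pmap_index[OF that]
      by (intro sum.cong refl) (simp add: x mult_add_less sum_distrib_right C_def)
    thus ?thesis by (simp only: sum.swap[of _ "{..<d1 * d1}" "{..<d1}"])
  qed
  show "psd (d2 * d2) (?Q X)"
  proof (rule psdI[OF tensor_map_carrier])
    fix r c assume rc: "r < d2 * d2" "c < d2 * d2"
    have "cnj (?Q X $$ (c, r)) = (\<Sum>t<d1 * d1. \<Sum>i<d1. \<Sum>j<d1. \<Sum>k<d1. \<Sum>l<d1.
      x t (j * d1 + l) * cnj (x t (i * d1 + k)) * C j i l k (r div d2) (r mod d2) (c div d2) (c mod d2))"
      unfolding entry[OF rc(2,1)] by (simp add: C_def cnj_pcoef mult_ac)
    also have "\<dots> = (\<Sum>t<d1 * d1. \<Sum>j<d1. \<Sum>i<d1. \<Sum>l<d1. \<Sum>k<d1.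
      x t (j * d1 + l) * cnj (x t (i * d1 + k)) * C j i l k (r div d2) (r mod d2) (c div d2) (c mod d2))"
    proof (rule sum.cong[OF refl])
      fix t
      have "(\<Sum>i<d1. \<Sum>j<d1. \<Sum>k<d1. \<Sum>l<d1. h i j k l) = (\<Sum>j<d1. \<Sum>i<d1. \<Sum>l<d1. \<Sum>k<d1. h i j k l)"
        for h :: "nat \<Rightarrow> nat \<Rightarrow> nat \<Rightarrow> nat \<Rightarrow> complex"
        by (subst sum.swap) (intro sum.cong refl sum.swap)
      thus "(\<Sum>i<d1. \<Sum>j<d1. \<Sum>k<d1. \<Sum>l<d1.
        x t (j * d1 + l) * cnj (x t (i * d1 + k)) * C j i l k (r div d2) (r mod d2) (c div d2) (c mod d2))
        = (\<Sum>j<d1. \<Sum>i<d1. \<Sum>l<d1. \<Sum>k<d1.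
        x t (j * d1 + l) * cnj (x t (i * d1 + k)) * C j i l k (r div d2) (r mod d2) (c div d2) (c mod d2))" .
    qed
    also have "\<dots> = ?Q X $$ (r, c)" by (rule entry[OF rc, symmetric])
    finally show "?Q X $$ (r, c) = cnj (?Q X $$ (c, r))" by (rule sym)
  next
    fix v :: "nat \<Rightarrow> complex"
    \<comment> \<open>The test vector and each rank-one vector are read as matrices indexed by the
      two tensor factors.\<close>
    define y where "y a a' = v (a * d2 + a')" for a a'
    define F where "F t = contract (\<gamma>\<^sup>2) \<mu> (\<lambda>i j a b. contract (\<gamma>\<^sup>2) \<mu> (\<lambda>k l a' b'.
        cnj (y a a') * y b b' * (x t (i * d1 + k) * cnj (x t (j * d1 + l)))))" for t
    define g where "g t r c = (\<Sum>i<d1. \<Sum>j<d1. \<Sum>k<d1. \<Sum>l<d1.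
      x t (i * d1 + k) * cnj (x t (j * d1 + l)) * C i j k l (r div d2) (r mod d2) (c div d2) (c mod d2))" for t r c
    have inner: "(\<Sum>r<d2 * d2. \<Sum>c<d2 * d2. cnj (v r) * g t r c * v c) = F t" for t
    proof -
      define h where "h a a' b b' = (\<Sum>i<d1. \<Sum>j<d1. \<Sum>k<d1. \<Sum>l<d1.
          pcoef (\<gamma>\<^sup>2) \<mu> i j a b * (pcoef (\<gamma>\<^sup>2) \<mu> k l a' b' *
            (cnj (y a a') * y b b' * (x t (i * d1 + k) * cnj (x t (j * d1 + l))))))" for a a' b b'
      have "cnj (v r) * g t r c * v c = h (r div d2) (r mod d2) (c div d2) (c mod d2)" for r c
        unfolding g_def h_def y_def C_def
        by (simp add: sum_distrib_left sum_distrib_right mult_ac)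
      hence "(\<Sum>r<d2 * d2. \<Sum>c<d2 * d2. cnj (v r) * g t r c * v c)
        = (\<Sum>r<d2 * d2. \<Sum>c<d2 * d2. h (r div d2) (r mod d2) (c div d2) (c mod d2))" by simp
      also have "\<dots> = (\<Sum>a<d2. \<Sum>a'<d2. \<Sum>b<d2. \<Sum>b'<d2. h a a' b b')"
        unfolding sum_div_mod[where f = "\<lambda>b b'. h _ _ b b'"]
        by (rule sum_div_mod[where f = "\<lambda>a a'. \<Sum>b<d2. \<Sum>b'<d2. h a a' b b'"])
      also have "\<dots> = (\<Sum>i<d1. \<Sum>j<d1. \<Sum>a<d2. \<Sum>b<d2. pcoef (\<gamma>\<^sup>2) \<mu> i j a b *
          (\<Sum>k<d1. \<Sum>l<d1. \<Sum>a'<d2. \<Sum>b'<d2. pcoef (\<gamma>\<^sup>2) \<mu> k l a' b' *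
            (cnj (y a a') * y b b' * (x t (i * d1 + k) * cnj (x t (j * d1 + l))))))"
        unfolding h_def sum8_reorder by (simp only: sum_distrib_left)
      also have "\<dots> = F t" unfolding F_def sum_pcoef_eq_contract[OF d] ..
      finally show ?thesis .
    qed
    have "\<exists>\<rho>\<ge>0. F t = of_real \<rho>" for t
      using contract_contract_nonneg[of "\<gamma>\<^sup>2" \<nu> \<mu> y "\<lambda>i k. x t (i * d1 + k)"] \<gamma> \<nu>
      unfolding F_def by (metis power_le_one less_imp_le zero_less_power)
    then obtain \<rho> where \<rho>: "\<And>t. \<rho> t \<ge> 0" "\<And>t. F t = of_real (\<rho> t)" by metis
    have "(\<Sum>r<d2 * d2. \<Sum>c<d2 * d2. cnj (v r) * ?Q X $$ (r, c) * v c)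
      = (\<Sum>r<d2 * d2. \<Sum>c<d2 * d2. \<Sum>t<d1 * d1. cnj (v r) * g t r c * v c)"
      by (intro sum.cong refl) (simp add: entry g_def sum_distrib_left sum_distrib_right)
    also have "\<dots> = (\<Sum>t<d1 * d1. \<Sum>r<d2 * d2. \<Sum>c<d2 * d2. cnj (v r) * g t r c * v c)"
      by (simp only: sum.swap[of _ "{..<d1 * d1}" "{..<d2 * d2}"])
    also have "\<dots> = of_real (\<Sum>t<d1 * d1. \<rho> t)" by (simp add: inner \<rho>)
    finally show "\<exists>\<rho>\<ge>0. (\<Sum>r<d2 * d2. \<Sum>c<d2 * d2. cnj (v r) * ?Q X $$ (r, c) * v c) = of_real \<rho>"
      using \<rho>(1) by (intro exI[of _ "\<Sum>t<d1 * d1. \<rho> t"]) (auto intro: sum_nonneg)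
  qed
qed

section \<open>Failure of decomposability\<close>

lemma not_decomposable_tensor_pmap:
  fixes \<gamma> \<mu> :: real
  assumes d: "d1 \<ge> 2" "d2 \<ge> 3" and \<gamma>: "\<gamma> > 0"
    and gap: "\<mu>\<^sup>2 * (1 - (\<gamma>\<^sup>2)\<^sup>2 - (\<gamma>\<^sup>2) ^ 3) > 3 * (\<gamma>\<^sup>2) ^ 3"
  shows "\<not> decomposable (d1 * d1) (d2 * d2) (tensor_map d1 d2 d1 d2 (pmap d1 d2 \<gamma> \<mu>) (pmap d1 d2 \<gamma> \<mu>))"
    (is "\<not> decomposable _ _ ?Q")
  \<comment> \<open>The witness is the PPT matrix whose Choi nodes are pairs of an input index I i k and an output
    index J a a'. Its only coherences are -k between (I 0 1, J 0 2) and (I 1 0, J 1 1), and -1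
    between (I 0 0, J 1 1) and (I 1 0, J 2 1); the partial transpose moves them to
    (I 0 1, J 1 1), (I 1 0, J 0 2) and to (I 0 0, J 2 1), (I 1 0, J 1 1). Since the Choi matrix of
    P \<otimes> P vanishes at the diagonal node (I 1 0, J 0 2), the large weight k^2/\<beta> there is free.\<close>
proof
  assume "decomposable (d1 * d1) (d2 * d2) ?Q"
  then obtain T S where T: "completely_positive (d1 * d1) (d2 * d2) T"
    and S: "completely_positive (d1 * d1) (d2 * d2) S"
    and Q: "\<And>A. A \<in> carrier_mat (d1 * d1) (d1 * d1) \<Longrightarrow> ?Q A = T A + transpose_mat (S A)"
    by (auto simp: decomposable_def)
  have less: "0 < d1" "1 < d1" "0 < d2" "1 < d2" "2 < d2" using d by auto
  define I where "I i k = i * d1 + k" for i k :: nat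
  define J where "J a a' = a * d2 + a'" for a a' :: nat
  define \<tau> where "\<tau> R C A B = Re (T (mat_unit (d1 * d1) R C) $$ (A, B))" for R C A B
  define \<sigma> where "\<sigma> R C A B = Re (S (mat_unit (d1 * d1) R C) $$ (A, B))" for R C A B
  have I: "I i k < d1 * d1" if "i < d1" "k < d1" for i k using mult_add_less[OF that] by (simp add: I_def)
  have J: "J a b < d2 * d2" if "a < d2" "b < d2" for a b using mult_add_less[OF that] by (simp add: J_def)
  note t = completely_positive_two_point[OF T, folded \<tau>_def]
  note s = completely_positive_two_point[OF S, folded \<sigma>_def]
  have sum: "\<tau> (I i k) (I j l) (J a a') (J b b') + \<sigma> (I i k) (I j l) (J b b') (J a a')
      = Re (pcoef (\<gamma>\<^sup>2) \<mu> i j a b * pcoef (\<gamma>\<^sup>2) \<mu> k l a' b')"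
    if "i < d1" "j < d1" "k < d1" "l < d1" "a < d2" "b < d2" "a' < d2" "b' < d2" for i j k l a a' b b'
  proof -
    have carrier: "T (mat_unit (d1 * d1) R C) \<in> carrier_mat (d2 * d2) (d2 * d2)"
      "S (mat_unit (d1 * d1) R C) \<in> carrier_mat (d2 * d2) (d2 * d2)" for R C
      using T S lin_map_carrier mat_unit_carrier unfolding completely_positive_def by blast+
    have "?Q (mat_unit (d1 * d1) (I i k) (I j l)) $$ (J a a', J b b')
      = T (mat_unit (d1 * d1) (I i k) (I j l)) $$ (J a a', J b b')
        + S (mat_unit (d1 * d1) (I i k) (I j l)) $$ (J b b', J a a')"
      using J that carrier_matD[OF carrier(1)] carrier_matD[OF carrier(2)]
      by (simp add: Q[OF mat_unit_carrier])
    moreover have "?Q (mat_unit (d1 * d1) (I i k) (I j l)) $$ (J a a', J b b')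
      = pcoef (\<gamma>\<^sup>2) \<mu> i j a b * pcoef (\<gamma>\<^sup>2) \<mu> k l a' b'"
      unfolding I_def J_def by (rule tensor_pmap_mat_unit_index[OF that])
    ultimately show ?thesis by (simp add: \<tau>_def \<sigma>_def)
  qed
  define \<beta> where "\<beta> = \<gamma>\<^sup>2"
  \<comment> \<open>This value minimises k^2 \<beta> - 2 k \<mu>, the contribution of
    \<open>e1\<close>, \<open>e3\<close> and \<open>e4\<close>; the minimum is - \<mu>^2 /
    \<beta>.\<close>
  define k where "k = \<mu> / \<beta>"
  have \<beta>: "\<beta> > 0" using \<gamma> by (simp add: \<beta>_def)
  have p: "pcoef \<beta> \<mu> 0 0 0 0 = 1" "pcoef \<beta> \<mu> 0 1 0 1 = of_real \<mu>" "pcoef \<beta> \<mu> 1 0 1 0 = of_real \<mu>"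
    "pcoef \<beta> \<mu> 1 1 1 1 = of_real (\<mu>\<^sup>2) + 1" "pcoef \<beta> \<mu> 0 0 1 1 = of_real \<beta>" "pcoef \<beta> \<mu> 1 1 2 2 = of_real \<beta>"
    "pcoef \<beta> \<mu> 1 0 2 1 = 1" "pcoef \<beta> \<mu> 0 1 1 2 = 1" "pcoef \<beta> \<mu> 0 0 2 2 = 1" "pcoef \<beta> \<mu> 1 1 0 0 = 0"
    by (simp_all add: pcoef_def)
  note sum' = sum[folded \<beta>_def]
  have e1: "\<tau> (I 0 1) (I 0 1) (J 0 2) (J 0 2) + \<sigma> (I 0 1) (I 0 1) (J 0 2) (J 0 2) = \<beta>"
    using sum'[of 0 0 1 1 0 0 2 2] less by (simp only: p) simp
  have e2: "\<tau> (I 1 0) (I 1 0) (J 1 1) (J 1 1) + \<sigma> (I 1 0) (I 1 0) (J 1 1) (J 1 1) = (\<mu>\<^sup>2 + 1) * \<beta>"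
    using sum'[of 1 1 0 0 1 1 1 1] less by (simp only: p) simp
  have e3: "\<tau> (I 0 1) (I 1 0) (J 0 2) (J 1 1) + \<sigma> (I 0 1) (I 1 0) (J 1 1) (J 0 2) = \<mu>"
    using sum'[of 0 1 1 0 0 1 2 1] less by (simp only: p) simp
  have e4: "\<tau> (I 1 0) (I 0 1) (J 1 1) (J 0 2) + \<sigma> (I 1 0) (I 0 1) (J 0 2) (J 1 1) = \<mu>"
    using sum'[of 1 0 0 1 1 0 1 2] less by (simp only: p) simp
  have e5: "\<tau> (I 0 0) (I 0 0) (J 1 1) (J 1 1) + \<sigma> (I 0 0) (I 0 0) (J 1 1) (J 1 1) = \<beta> * \<beta>"
    using sum'[of 0 0 0 0 1 1 1 1] less by (simp only: p) simp
  have e6: "\<tau> (I 1 0) (I 1 0) (J 2 1) (J 2 1) + \<sigma> (I 1 0) (I 1 0) (J 2 1) (J 2 1) = \<beta> * \<beta>"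
    using sum'[of 1 1 0 0 2 2 1 1] less by (simp only: p) simp
  have e7: "\<tau> (I 0 0) (I 1 0) (J 1 1) (J 2 1) + \<sigma> (I 0 0) (I 1 0) (J 2 1) (J 1 1) = \<beta>"
    using sum'[of 0 1 0 0 1 2 1 1] less by (simp only: p) simp
  have e8: "\<tau> (I 1 0) (I 0 0) (J 2 1) (J 1 1) + \<sigma> (I 1 0) (I 0 0) (J 1 1) (J 2 1) = \<beta>"
    using sum'[of 1 0 0 0 2 1 1 1] less by (simp only: p) simp
  have e9: "\<tau> (I 0 0) (I 0 0) (J 2 1) (J 2 1) + \<sigma> (I 0 0) (I 0 0) (J 2 1) (J 2 1) = \<beta>"
    using sum'[of 0 0 0 0 2 2 1 1] less by (simp only: p) simp
  have e10: "\<tau> (I 0 1) (I 0 1) (J 1 1) (J 1 1) + \<sigma> (I 0 1) (I 0 1) (J 1 1) (J 1 1) = \<beta> * (\<mu>\<^sup>2 + 1)"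
    using sum'[of 0 0 1 1 1 1 1 1] less by (simp only: p) simp
  have e11: "\<tau> (I 1 0) (I 1 0) (J 0 2) (J 0 2) + \<sigma> (I 1 0) (I 1 0) (J 0 2) (J 0 2) = 0"
    using sum'[of 1 1 0 0 0 0 2 2] less by (simp only: p) simp
  note less' = I[OF less(1) less(1)] I[OF less(1) less(2)] I[OF less(2) less(1)]
    J[OF less(3) less(5)] J[OF less(4) less(4)] J[OF less(5) less(4)]
  \<comment> \<open>The test vector (\<gamma>, - k / \<gamma>) has weights \<beta> and k^2 / \<beta>
    but still the coherence - k that the partial transpose of the witness demands.\<close>
  have kg: "(- (k / \<gamma>))\<^sup>2 = k\<^sup>2 / \<beta>" "\<gamma> * - (k / \<gamma>) = - k" "\<gamma>\<^sup>2 = \<beta>"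
    using \<gamma> by (simp_all add: \<beta>_def power_divide)
  \<comment> \<open>T is tested on the two coherent pairs of the witness and S on the two pairs of
    its partial transpose. The one-point inequalities supply, for each diagonal node, the part of T
    or S that no pair provides.\<close>
  have "0 \<le> k\<^sup>2 * \<tau> (I 0 1) (I 0 1) (J 0 2) (J 0 2) + \<tau> (I 1 0) (I 1 0) (J 1 1) (J 1 1)
      - k * (\<tau> (I 0 1) (I 1 0) (J 0 2) (J 1 1) + \<tau> (I 1 0) (I 0 1) (J 1 1) (J 0 2))"
    using t[of "I 0 1" "I 1 0" "J 0 2" "J 1 1" k "-1"] less' by simp
  moreover have "0 \<le> \<tau> (I 0 0) (I 0 0) (J 1 1) (J 1 1) + \<tau> (I 1 0) (I 1 0) (J 2 1) (J 2 1)
      - (\<tau> (I 0 0) (I 1 0) (J 1 1) (J 2 1) + \<tau> (I 1 0) (I 0 0) (J 2 1) (J 1 1))"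
    using t[of "I 0 0" "I 1 0" "J 1 1" "J 2 1" 1 "-1"] less' by simp
  moreover have "0 \<le> \<tau> (I 0 0) (I 0 0) (J 2 1) (J 2 1)"
    using t[of "I 0 0" "I 0 0" "J 2 1" "J 2 1" 1 0] less' by simp
  moreover have "0 \<le> \<beta> * \<tau> (I 0 1) (I 0 1) (J 1 1) (J 1 1)"
    using t[of "I 0 1" "I 0 1" "J 1 1" "J 1 1" \<gamma> 0] less' by (simp add: kg)
  moreover have "0 \<le> k\<^sup>2 / \<beta> * \<tau> (I 1 0) (I 1 0) (J 0 2) (J 0 2)"
    using t[of "I 1 0" "I 1 0" "J 0 2" "J 0 2" 1 0] less' \<beta> by simp
  moreover have "0 \<le> \<beta> * \<sigma> (I 0 1) (I 0 1) (J 1 1) (J 1 1) + k\<^sup>2 / \<beta> * \<sigma> (I 1 0) (I 1 0) (J 0 2) (J 0 2)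
      - k * (\<sigma> (I 0 1) (I 1 0) (J 1 1) (J 0 2) + \<sigma> (I 1 0) (I 0 1) (J 0 2) (J 1 1))"
    using s[of "I 0 1" "I 1 0" "J 1 1" "J 0 2" \<gamma> "- (k / \<gamma>)"] less' unfolding kg by simp
  moreover have "0 \<le> \<sigma> (I 0 0) (I 0 0) (J 2 1) (J 2 1) + \<sigma> (I 1 0) (I 1 0) (J 1 1) (J 1 1)
      - (\<sigma> (I 0 0) (I 1 0) (J 2 1) (J 1 1) + \<sigma> (I 1 0) (I 0 0) (J 1 1) (J 2 1))"
    using s[of "I 0 0" "I 1 0" "J 2 1" "J 1 1" 1 "-1"] less' by simp
  moreover have "0 \<le> k\<^sup>2 * \<sigma> (I 0 1) (I 0 1) (J 0 2) (J 0 2)"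
    using s[of "I 0 1" "I 0 1" "J 0 2" "J 0 2" 1 0] less' by simp
  moreover have "0 \<le> \<sigma> (I 0 0) (I 0 0) (J 1 1) (J 1 1)"
    using s[of "I 0 0" "I 0 0" "J 1 1" "J 1 1" 1 0] less' by simp
  moreover have "0 \<le> \<sigma> (I 1 0) (I 1 0) (J 2 1) (J 2 1)"
    using s[of "I 1 0" "I 1 0" "J 2 1" "J 2 1" 1 0] less' by simp
  \<comment> \<open>In the sum every entry of T meets its transposed partner from S, so only entries
    of P \<otimes> P itself remain.\<close>
  ultimately have "0 \<le> k\<^sup>2 * (\<tau> (I 0 1) (I 0 1) (J 0 2) (J 0 2) + \<sigma> (I 0 1) (I 0 1) (J 0 2) (J 0 2))
      + (\<tau> (I 1 0) (I 1 0) (J 1 1) (J 1 1) + \<sigma> (I 1 0) (I 1 0) (J 1 1) (J 1 1))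
      - k * ((\<tau> (I 0 1) (I 1 0) (J 0 2) (J 1 1) + \<sigma> (I 0 1) (I 1 0) (J 1 1) (J 0 2))
           + (\<tau> (I 1 0) (I 0 1) (J 1 1) (J 0 2) + \<sigma> (I 1 0) (I 0 1) (J 0 2) (J 1 1)))
      + (\<tau> (I 0 0) (I 0 0) (J 1 1) (J 1 1) + \<sigma> (I 0 0) (I 0 0) (J 1 1) (J 1 1))
      + (\<tau> (I 1 0) (I 1 0) (J 2 1) (J 2 1) + \<sigma> (I 1 0) (I 1 0) (J 2 1) (J 2 1))
      - (\<tau> (I 0 0) (I 1 0) (J 1 1) (J 2 1) + \<sigma> (I 0 0) (I 1 0) (J 2 1) (J 1 1))
      - (\<tau> (I 1 0) (I 0 0) (J 2 1) (J 1 1) + \<sigma> (I 1 0) (I 0 0) (J 1 1) (J 2 1))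
      + (\<tau> (I 0 0) (I 0 0) (J 2 1) (J 2 1) + \<sigma> (I 0 0) (I 0 0) (J 2 1) (J 2 1))
      + \<beta> * (\<tau> (I 0 1) (I 0 1) (J 1 1) (J 1 1) + \<sigma> (I 0 1) (I 0 1) (J 1 1) (J 1 1))
      + k\<^sup>2 / \<beta> * (\<tau> (I 1 0) (I 1 0) (J 0 2) (J 0 2) + \<sigma> (I 1 0) (I 1 0) (J 0 2) (J 0 2))"
    unfolding distrib_left by linarith
  hence "0 \<le> k\<^sup>2 * \<beta> + (\<mu>\<^sup>2 + 1) * \<beta> - k * (\<mu> + \<mu>) + \<beta> * \<beta> + \<beta> * \<beta> - \<beta> - \<beta> + \<beta>
      + \<beta> * (\<beta> * (\<mu>\<^sup>2 + 1)) + k\<^sup>2 / \<beta> * 0"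
    unfolding e1 e2 e3 e4 e5 e6 e7 e8 e9 e10 e11 .
  \<comment> \<open>The terms linear in \<beta> cancel between \<open>e2\<close>, \<open>e7\<close>,
    \<open>e8\<close> and \<open>e9\<close>. The leading terms left are - \<mu>^2 / \<beta> and 3
    \<beta>^2, hence the comparison of \<mu>^2 with 3 \<beta>^3.\<close>
  hence "0 \<le> - \<mu>\<^sup>2 / \<beta> + \<beta> * \<mu>\<^sup>2 + 3 * \<beta>\<^sup>2 + \<beta>\<^sup>2 * \<mu>\<^sup>2"
    using \<beta> by (simp add: k_def power2_eq_square algebra_simps)
  hence "0 \<le> \<beta> * (- \<mu>\<^sup>2 / \<beta> + \<beta> * \<mu>\<^sup>2 + 3 * \<beta>\<^sup>2 + \<beta>\<^sup>2 * \<mu>\<^sup>2)" using \<beta> by simp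
  hence "\<mu>\<^sup>2 * (1 - \<beta>\<^sup>2 - \<beta> ^ 3) \<le> 3 * \<beta> ^ 3"
    using \<beta> by (simp add: power2_eq_square power3_eq_cube algebra_simps)
  thus False using gap by (simp add: \<beta>_def)
qed


section \<open>Choice of the parameters and conclusion\<close>

lemma decomposable_pmap: "decomposable d1 d2 (pmap d1 d2 \<gamma> \<mu>)"
  unfolding decomposable_def pmap_def using completely_positive_kraus by blast

lemma lin_map_pmap: "lin_map d1 d2 (pmap d1 d2 \<gamma> \<mu>)"
  unfolding lin_map_def
proof (intro conjI ballI allI)
  fix A B :: "complex mat" and c :: complex
  let ?T = "kraus d1 d2 3 (cp_kraus \<gamma> \<mu>)" and ?S = "kraus d1 d2 1 cocp_kraus"
  note T = lin_map_kraus[of d1 d2 3 "cp_kraus \<gamma> \<mu>", unfolded lin_map_def]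
  note S = lin_map_kraus[of d1 d2 1 cocp_kraus, unfolded lin_map_def]
  have dim: "kraus d1 d2 N K X \<in> carrier_mat d2 d2" for N K X by (simp add: kraus_def)
  assume A: "A \<in> carrier_mat d1 d1"
  show "pmap d1 d2 \<gamma> \<mu> A \<in> carrier_mat d2 d2" using dim by (simp add: pmap_def)
  have "?T (c \<cdot>\<^sub>m A) = c \<cdot>\<^sub>m ?T A" "?S (c \<cdot>\<^sub>m A) = c \<cdot>\<^sub>m ?S A" using T S A by blast+
  thus "pmap d1 d2 \<gamma> \<mu> (c \<cdot>\<^sub>m A) = c \<cdot>\<^sub>m pmap d1 d2 \<gamma> \<mu> A"
    unfolding pmap_def using carrier_matD[OF dim[of 3 "cp_kraus \<gamma> \<mu>" A]] carrier_matD[OF dim[of 1 cocp_kraus A]]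
    by (simp only:) (rule eq_matI, auto simp: algebra_simps)
  assume B: "B \<in> carrier_mat d1 d1"
  have "?T (A + B) = ?T A + ?T B" "?S (A + B) = ?S A + ?S B" using T S A B by blast+
  thus "pmap d1 d2 \<gamma> \<mu> (A + B) = pmap d1 d2 \<gamma> \<mu> A + pmap d1 d2 \<gamma> \<mu> B"
    unfolding pmap_def using carrier_matD[OF dim[of 3 "cp_kraus \<gamma> \<mu>" A]] carrier_matD[OF dim[of 1 cocp_kraus A]]
      carrier_matD[OF dim[of 3 "cp_kraus \<gamma> \<mu>" B]] carrier_matD[OF dim[of 1 cocp_kraus B]]
    by (simp only:) (rule eq_matI, auto)
qed

theorem mainTheorem20:
  fixes d1 d2 :: nat
  assumes "d1 \<ge> 2" and "d2 \<ge> 4"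
  shows "\<exists>P. lin_map d1 d2 P \<and> decomposable d1 d2 P \<and>
           positive_map (d1 * d1) (d2 * d2) (tensor_map d1 d2 d1 d2 P P) \<and>
           \<not> decomposable (d1 * d1) (d2 * d2) (tensor_map d1 d2 d1 d2 P P)"
proof (intro exI conjI)
  \<comment> \<open>Here \<beta> = 10^-6 and \<mu>^2 = 4 * 10^-18, so \<nu> = 2 \<mu>^2 / \<beta>^2
    = 8 * 10^-6. The condition 400 \<nu>^2 \<le> \<beta> means \<mu>^2 \<le> \<beta>^(5/2) / 40 =
    2.5 * 10^-17, while the gap requires slightly more than 3 \<beta>^3 = 3 * 10^-18. Such a window
    exists once sqrt \<beta> is below about 1/120.\<close>
  let ?P = "pmap d1 d2 (1 / 10 ^ 3) (2 / 10 ^ 9)"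
  have d2: "d2 \<ge> 3" using assms(2) by simp
  show "lin_map d1 d2 ?P" "decomposable d1 d2 ?P" by (rule lin_map_pmap decomposable_pmap)+
  show "positive_map (d1 * d1) (d2 * d2) (tensor_map d1 d2 d1 d2 ?P ?P)"
    by (rule positive_map_tensor_pmap[OF assms(1) d2, where \<nu> = "8 / 10 ^ 6"])
       (simp_all add: power2_eq_square)
  show "\<not> decomposable (d1 * d1) (d2 * d2) (tensor_map d1 d2 d1 d2 ?P ?P)"
    by (rule not_decomposable_tensor_pmap[OF assms(1) d2]) (simp_all add: power2_eq_square power3_eq_cube)
qed

end
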